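(* Let $\lambda\in\mathbb{R}\setminus[-1,1]$, $m\in\mathbb{N}$, let $a_1,\dots,a_m\in\mathbb{C}\setminus\{0\}$ satisfy $a_1+\cdots+a_m=|\lambda|$, let $\tau_1<\cdots<\tau_m$ be real numbers, and set $A(y)=|\lambda|^{-1}\sum_{j=1}^m a_j e^{2\pi i\tau_j y}$ for $y\in\mathbb{R}$. Let $d$ be the maximal number of elements of $\{\tau_1,\dots,\tau_m\}$ that are linearly independent over $\mathbb{Q}$, and let $r_1,\dots,r_d\in\mathbb{R}$ (linearly independent over $\mathbb{Q}$) and a Laurent polynomial $P(z_1,\dots,z_d)$ with complex coefficients be such that $A(y)=P(e^{2\pi i r_1y},\dots,e^{2\pi i r_dy})$ for all $y\in\mathbb{R}$. Then $\ln|A|$ is almost periodic in the mean squared sense of Besicovitch, and $$\lim_{L\to\infty}\frac{1}{2L}\int_{-L}^{L}\ln|A(y)|\,dy=\ln M(P),$$ where $M(P)$ is the Mahler measure of $P$.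
   Context: The Mahler measure of a nonzero (Laurent) polynomial $P(z_1,\dots,z_d)$ is $$M(P)=\exp\int_0^1\cdots\int_0^1\ln|P(e^{2\pi i t_1},\dots,e^{2\pi i t_d})|\,dt_1\cdots dt_d.$$ Such $r_1,\dots,r_d$ and $P$ always exist. In the degenerate case $d=0$ (that is, $m=1$ and $\tau_1=0$) one has $A\equiv1$, and $P$ is the constant $1$ with $M(P)=1$. A function $g:\mathbb{R}\to\mathbb{C}$ (defined almost everywhere, locally square integrable) is almost periodic in the mean squared sense of Besicovitch if for every $\varepsilon>0$ there is a finite trigonometric polynomial $Q(y)=\sum_k b_k e^{2\pi i s_k y}$ with $b_k\in\mathbb{C}$ and $s_k\in\mathbb{R}$ such that $\limsup_{L\to\infty}\frac{1}{2L}\int_{-L}^{L}|g(y)-Q(y)|^2\,dy<\varepsilon$. *)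

theory Defs
  imports "HOL-Analysis.Analysis" "HOL-Library.Poly_Mapping"
begin

abbreviation e2pi :: "real \<Rightarrow> complex" where
  "e2pi x \<equiv> exp (2 * complex_of_real pi * \<i> * complex_of_real x)"

text \<open>The real numbers regarded as a vector space over the rationals.\<close>

abbreviation rat_independent :: "real set \<Rightarrow> bool" where
  "rat_independent \<equiv> module.independent (\<lambda>q :: rat. (*) (real_of_rat q))"

lemma vector_space_rat_real: "vector_space (\<lambda>q :: rat. (*) (real_of_rat q))"
  by unfold_locales (simp_all add: algebra_simps of_rat_add of_rat_mult)

text \<open>
  A Laurent polynomial is a finitely supported family of coefficients indexed by exponent
  vectors, which are themselves finitely supported families of integers indexed by the variables.
  The ring structure on \<^typ>\<open>(nat \<Rightarrow>\<^sub>0 int) \<Rightarrow>\<^sub>0 complex\<close> is that of the Laurent polynomial ring.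
\<close>

type_synonym laurent_poly = "(nat \<Rightarrow>\<^sub>0 int) \<Rightarrow>\<^sub>0 complex"

text \<open>Only the variables \<open>z\<^sub>1, \<dots>, z\<^sub>d\<close> occur.\<close>

definition laurent_in :: "nat \<Rightarrow> laurent_poly \<Rightarrow> bool" where
  "laurent_in d P \<longleftrightarrow> (\<forall>\<alpha>\<in>Poly_Mapping.keys P. Poly_Mapping.keys \<alpha> \<subseteq> {1..d})"

definition laurent_eval :: "laurent_poly \<Rightarrow> (nat \<Rightarrow> complex) \<Rightarrow> complex" where
  "laurent_eval P z =
     (\<Sum>\<alpha>\<in>Poly_Mapping.keys P. Poly_Mapping.lookup P \<alpha> *
        (\<Prod>i\<in>Poly_Mapping.keys \<alpha>. z i powi Poly_Mapping.lookup \<alpha> i))"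

text \<open>
  The Mahler measure of a nonzero Laurent polynomial in \<open>z\<^sub>1, \<dots>, z\<^sub>d\<close>. The \<open>d\<close>-fold
  integral is taken with respect to the product Lebesgue measure on the unit cube. For \<open>d = 0\<close>
  the cube is a single point of measure 1, so the value is the modulus of the constant \<open>P\<close>.
  The convention \<open>ln 0 = 0\<close> matters only on the zero set of \<open>P\<close> in the torus, which is
  a null set.
\<close>

definition mahler_measure :: "nat \<Rightarrow> laurent_poly \<Rightarrow> real" where
  "mahler_measure d P =
     exp (LINT t : ({1..d} \<rightarrow>\<^sub>E {0..1}) | (\<Pi>\<^sub>M i\<in>{1..d}. lborel).
            ln (cmod (laurent_eval P (\<lambda>i. e2pi (t i)))))"

definition trig_poly :: "(real \<Rightarrow> complex) \<Rightarrow> bool" where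
  "trig_poly Q \<longleftrightarrow>
     (\<exists>(n :: nat) (b :: nat \<Rightarrow> complex) (s :: nat \<Rightarrow> real).
        Q = (\<lambda>y. \<Sum>k<n. b k * e2pi (s k * y)))"

text \<open>
  Almost periodicity in the mean squared sense of Besicovitch, including measurability and local
  square integrability of \<open>g\<close>. None of the conditions changes when \<open>g\<close> is modified on a null
  set, so a function defined almost everywhere may be extended arbitrarily.
\<close>

definition besicovitch_ap2 :: "(real \<Rightarrow> complex) \<Rightarrow> bool" where
  "besicovitch_ap2 g \<longleftrightarrow>
     g \<in> borel_measurable lebesgue \<and>
     (\<forall>K. compact K \<longrightarrow> set_integrable lebesgue K (\<lambda>y. (cmod (g y))\<^sup>2)) \<and>
     (\<forall>\<epsilon>::real. \<epsilon> > 0 \<longrightarrow>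
        (\<exists>Q. trig_poly Q \<and>
           Limsup at_top (\<lambda>L::real.
              ereal (1 / (2 * L) * (LINT y : {-L..L} | lebesgue. (cmod (g y - Q y))\<^sup>2)))
             < ereal \<epsilon>))"

end

theory Submission
  imports Defs "HOL-Computational_Algebra.Polynomial"
begin

text \<open>
  The exponential sum \<open>A\<close> has only nonzero coefficients and distinct frequencies, so a linear
  combination of its first derivatives (read off from a Lagrange polynomial) is a single
  exponential. Hence at every real point one of these derivatives is bounded below by a uniform
  constant, and a mean value argument gives the sublevel estimate
  \<open>|{y \<in> [x, x + h]. \<bar>A y\<bar> \<le> c e\<^sup>n}| \<le> K e\<close> uniformly in \<open>x\<close>. So truncating
  \<open>ln \<bar>A\<bar>\<close> from below at \<open>ln \<delta>\<close> changes it little in \<open>L\<^sup>1\<close> and \<open>L\<^sup>2\<close> mean, uniformly over all long intervals.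
  The truncation is a continuous function of \<open>\<bar>A\<bar>\<^sup>2\<close> and therefore a uniform limit of polynomials
  in \<open>\<bar>A\<bar>\<^sup>2\<close>, which are trigonometric polynomials. For these, Kronecker--Weyl equidistribution is
  the elementary computation of the mean of a monomial. On the torus the truncations decrease to
  \<open>ln \<bar>P\<bar>\<close> with bounded integrals, so monotone convergence identifies the limit.
\<close>

subsection \<open>Sublevel sets of exponential sums\<close>

text \<open>Induction on the order of the derivative. By the mean value theorem the points where
  \<open>g k\<close> is small are at most \<open>2 * e\<close> apart, because the next derivative
  has modulus at least \<open>c\<close>. To the left and right of them
  \<open>\<bar>g k y\<bar>\<close> is at least \<open>c * e\<close>, so the induction hypothesis
  applies there with \<open>c * e\<close> for \<open>c\<close>.\<close>

lemma sublevel_cover: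
  fixes g :: "nat \<Rightarrow> real \<Rightarrow> real"
  assumes der: "\<And>k y. (g k has_real_derivative g (Suc k) y) (at y)"
    and e: "0 < e" "e < 1"
  shows "is_interval J \<Longrightarrow> 0 < c \<Longrightarrow> (\<forall>y\<in>J. c \<le> \<bar>g k y\<bar>) \<Longrightarrow>
    \<exists>B\<in>sets lborel. {y \<in> J. \<bar>g 0 y\<bar> \<le> c * e ^ Suc k} \<subseteq> B \<and> emeasure lborel B \<le> ennreal (6 ^ k * e)"
proof (induction k arbitrary: J c)
  case 0
  have "c * e < c" using e 0 by simp
  then have "{y \<in> J. \<bar>g 0 y\<bar> \<le> c * e ^ Suc 0} = {}" using 0(3) by force
  then show ?case by (intro bexI[of _ "{}"]) auto
next
  case (Suc k)
  define S where "S = {y\<in>J. \<bar>g k y\<bar> < c * e}"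
  \<comment> \<open>\<open>J1\<close>, \<open>J2\<close> and \<open>J3\<close> are the parts of
    \<open>J\<close> left of \<open>S\<close>, in its convex hull, and right of it. If
    \<open>S\<close> is empty, \<open>J1\<close> and \<open>J3\<close> are both all of
    \<open>J\<close>, which does no harm.\<close>
  define J1 where "J1 = {y\<in>J. \<forall>s\<in>S. y < s}"
  define J2 where "J2 = {y\<in>J. \<exists>s\<in>S. \<exists>s'\<in>S. s \<le> y \<and> y \<le> s'}"
  define J3 where "J3 = {y\<in>J. \<forall>s\<in>S. s < y}"
  have ce: "0 < c * e" using e Suc by simp
  have i1: "is_interval J1"
    using Suc.prems(1) unfolding is_interval_1 J1_def by (smt (verit) mem_Collect_eq)
  have i3: "is_interval J3"
    using Suc.prems(1) unfolding is_interval_1 J3_def by (smt (verit) mem_Collect_eq)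
  have b1: "\<forall>y\<in>J1. c * e \<le> \<bar>g k y\<bar>" and b3: "\<forall>y\<in>J3. c * e \<le> \<bar>g k y\<bar>"
    unfolding J1_def J3_def S_def by (force simp: not_less)+
  obtain B1 where B1: "B1 \<in> sets lborel" "{y \<in> J1. \<bar>g 0 y\<bar> \<le> c * e * e ^ Suc k} \<subseteq> B1"
      "emeasure lborel B1 \<le> ennreal (6 ^ k * e)"
    using Suc.IH[OF i1 ce b1] by blast
  obtain B3 where B3: "B3 \<in> sets lborel" "{y \<in> J3. \<bar>g 0 y\<bar> \<le> c * e * e ^ Suc k} \<subseteq> B3"
      "emeasure lborel B3 \<le> ennreal (6 ^ k * e)"
    using Suc.IH[OF i3 ce b3] by blast
  have diam: "s' - s \<le> 2 * e" if s: "s \<in> S" "s' \<in> S" for s s'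
  proof (cases "s < s'")
    case True
    obtain z where z: "s < z" "z < s'" "g k s' - g k s = (s' - s) * g (Suc k) z"
      using MVT2[OF True, of "g k" "g (Suc k)"] der by blast
    have "z \<in> J"
      by (rule mem_is_interval_1_I[OF Suc.prems(1), of s s']) (use s z in \<open>auto simp: S_def\<close>)
    then have "c * (s' - s) \<le> \<bar>g (Suc k) z\<bar> * (s' - s)"
      using Suc.prems(3) True by (intro mult_right_mono) auto
    also have "\<dots> = \<bar>g k s' - g k s\<bar>"
      using z True by (simp add: abs_mult)
    also have "\<dots> \<le> c * (2 * e)"
      using s unfolding S_def by auto
    finally show ?thesis using Suc.prems(2) by simp
  qed (use e in auto)
  have J2d: "y' - y \<le> 2 * e" if "y \<in> J2" "y' \<in> J2" for y y'
    using that diam unfolding J2_def by (smt (verit) mem_Collect_eq)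
  \<comment> \<open>The diameter bound does not locate \<open>J2\<close>, so it is enclosed
    symmetrically around one of its points, at the price of length \<open>4 * e\<close>.\<close>
  obtain B2 :: "real set" where B2: "B2 \<in> sets lborel" "J2 \<subseteq> B2"
      "emeasure lborel B2 \<le> ennreal (4 * e)"
  proof (cases "J2 = {}")
    case True
    then show ?thesis using that[of "{}"] by simp
  next
    case False
    then obtain y0 where y0: "y0 \<in> J2" by blast
    have "J2 \<subseteq> {y0 - 2 * e .. y0 + 2 * e}"
      using J2d[OF y0] J2d[OF _ y0] by (force simp: algebra_simps)
    then show ?thesis using that[of "{y0 - 2 * e .. y0 + 2 * e}"] e by simp
  qed
  have cover: "J \<subseteq> J1 \<union> J2 \<union> J3"
    unfolding J1_def J2_def J3_def using not_less by blast
  have "{y \<in> J. \<bar>g 0 y\<bar> \<le> c * e ^ Suc (Suc k)} \<subseteq> B1 \<union> B2 \<union> B3"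
    using B1(2) B2(2) B3(2) cover by (auto simp: mult.assoc)
  moreover have "emeasure lborel (B1 \<union> B2 \<union> B3) \<le> ennreal (6 ^ Suc k * e)"
  proof -
    have "emeasure lborel (B1 \<union> B2 \<union> B3)
        \<le> emeasure lborel B1 + emeasure lborel B2 + emeasure lborel B3"
      using B1(1) B2(1) B3(1)
      by (meson add_right_mono emeasure_subadditive order_trans sets.Un)
    also have "\<dots> \<le> ennreal (6 ^ k * e) + ennreal (4 * e) + ennreal (6 ^ k * e)"
      using B1 B2 B3 by (intro add_mono) auto
    also have "\<dots> = ennreal (6 ^ k * e + 4 * e + 6 ^ k * e)"
      using e by (simp flip: ennreal_plus)
    \<comment> \<open>Two copies of the previous bound plus \<open>4 * e\<close>: the factor 6
      absorbs this because \<open>1 \<le> 6 ^ k\<close>.\<close>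
    also have "\<dots> \<le> ennreal (6 ^ Suc k * e)"
    proof (rule ennreal_leI)
      have "(1::real) \<le> 6 ^ k" by simp
      then have "4 * e \<le> 4 * 6 ^ k * e" using e by (intro mult_right_mono) auto
      then show "6 ^ k * e + 4 * e + 6 ^ k * e \<le> 6 ^ Suc k * e" by (simp add: algebra_simps)
    qed
    finally show ?thesis .
  qed
  ultimately show ?case using B1 B2 B3 by blast
qed

text \<open>The index \<open>k\<close> counts derivatives: \<open>k = 0\<close> is the exponential
  sum itself, and each further step differentiates once more.\<close>

definition exp_sum :: "'i set \<Rightarrow> ('i \<Rightarrow> complex) \<Rightarrow> ('i \<Rightarrow> real) \<Rightarrow> nat \<Rightarrow> real \<Rightarrow> complex" where
  "exp_sum I a \<tau> k y = (\<Sum>j\<in>I. a j * (2 * complex_of_real pi * \<i> * complex_of_real (\<tau> j)) ^ k * e2pi (\<tau> j * y))"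

lemma norm_e2pi [simp]: "cmod (e2pi x) = 1"
  by (simp add: norm_exp_eq_Re)

lemma has_vector_derivative_e2pi:
  "((\<lambda>y. e2pi (t * y)) has_vector_derivative
      2 * complex_of_real pi * \<i> * complex_of_real t * e2pi (t * y)) (at y within X)" 
proof -
  have "((\<lambda>z. exp (2 * complex_of_real pi * \<i> * (complex_of_real t * z))) has_field_derivative
      2 * complex_of_real pi * \<i> * complex_of_real t * e2pi (t * y)) (at (complex_of_real y))"
    by (auto intro!: derivative_eq_intros)
  from has_vector_derivative_real_field[OF this] show ?thesis by simp
qed

lemma has_vector_derivative_exp_sum:
  "(exp_sum I a \<tau> k has_vector_derivative exp_sum I a \<tau> (Suc k) y) (at y)"
  unfolding exp_sum_def
  by (rule has_vector_derivative_eq_rhs, rule has_vector_derivative_sum,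
      rule has_vector_derivative_mult_right, rule has_vector_derivative_e2pi)
     (simp add: algebra_simps)

lemma norm_exp_sum_le:
  "cmod (exp_sum I a \<tau> k y) \<le> (\<Sum>j\<in>I. cmod (a j) * (2 * pi * \<bar>\<tau> j\<bar>) ^ k)"
  unfolding exp_sum_def
  by (rule order_trans[OF norm_sum]) (simp add: norm_mult norm_power)

text \<open>A differential operator with constant coefficients, of order below
  \<open>card I\<close>, annihilates every term except that of \<open>j0\<close> and leaves an
  exponential of constant modulus. So the derivatives of order below \<open>card I\<close> cannot
  all be small at the same point.\<close>

lemma exp_sum_derivs_lower:
  assumes I: "finite I" "inj_on \<tau> I" "j0 \<in> I" "a j0 \<noteq> 0"
  shows "\<exists>c>0. \<forall>y. \<exists>k<card I. c \<le> cmod (exp_sum I a \<tau> k y)"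
proof -
  define l where "l j = 2 * complex_of_real pi * \<i> * complex_of_real (\<tau> j)" for j
  \<comment> \<open>Up to normalisation this is the Lagrange polynomial of \<open>j0\<close> for the
    nodes \<open>l j\<close>, which are distinct because \<open>\<tau>\<close> is injective.\<close>
  define p where "p = (\<Prod>j\<in>I - {j0}. [:- l j, 1:])"
  have degp: "degree p < card I"
  proof -
    have "degree p \<le> (\<Sum>j\<in>I - {j0}. degree [:- l j, 1:])"
      unfolding p_def using degree_prod_sum_le[of "I - {j0}" "\<lambda>j. [:- l j, 1:]"] I by (simp add: o_def)
    also have "\<dots> = card I - 1" using I by simp
    also have "\<dots> < card I" using I by (metis card_gt_0_iff diff_less empty_iff zero_less_one)
    finally show ?thesis .
  qed
  have p0: "poly p (l j) = 0" if "j \<in> I" "j \<noteq> j0" for j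
    using that I by (auto simp: p_def poly_prod intro!: prod_zero)
  have p1: "poly p (l j0) \<noteq> 0"
    using I by (auto simp: p_def poly_prod l_def inj_on_def)
  have key: "(\<Sum>k\<le>degree p. coeff p k * exp_sum I a \<tau> k y) = a j0 * poly p (l j0) * e2pi (\<tau> j0 * y)" for y
  proof -
    have "(\<Sum>k\<le>degree p. coeff p k * exp_sum I a \<tau> k y)
        = (\<Sum>j\<in>I. \<Sum>k\<le>degree p. coeff p k * (a j * l j ^ k * e2pi (\<tau> j * y)))"
      unfolding exp_sum_def l_def sum_distrib_left by (rule sum.swap)
    also have "\<dots> = (\<Sum>j\<in>I. a j * poly p (l j) * e2pi (\<tau> j * y))"
      by (simp add: poly_altdef sum_distrib_left sum_distrib_right algebra_simps)
    also have "\<dots> = (\<Sum>j\<in>I. if j = j0 then a j * poly p (l j) * e2pi (\<tau> j * y) else 0)"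
      using p0 by (intro sum.cong) auto
    finally show ?thesis using I by simp
  qed
  define s where "s = (\<Sum>k\<le>degree p. cmod (coeff p k))"
  \<comment> \<open>Dividing by \<open>1 + s\<close> rather than \<open>s\<close> makes the final
    comparison strict.\<close>
  define c where "c = cmod (a j0 * poly p (l j0)) / (1 + s)"
  have s: "0 \<le> s" unfolding s_def by (simp add: sum_nonneg)
  have q: "0 < cmod (a j0 * poly p (l j0))" using p1 I by simp
  have c: "0 < c" unfolding c_def using s q by simp
  have "\<exists>k<card I. c \<le> cmod (exp_sum I a \<tau> k y)" for y
  proof (rule ccontr)
    assume "\<not> ?thesis"
    then have *: "cmod (exp_sum I a \<tau> k y) \<le> c" if "k \<le> degree p" for k
      using that degp by (meson le_less_trans linear)
    have "cmod (a j0 * poly p (l j0)) = cmod (\<Sum>k\<le>degree p. coeff p k * exp_sum I a \<tau> k y)"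
      unfolding key norm_mult by simp
    also have "\<dots> \<le> (\<Sum>k\<le>degree p. cmod (coeff p k) * c)"
      by (rule order_trans[OF norm_sum]) (auto simp: norm_mult intro!: sum_mono mult_left_mono *)
    also have "\<dots> = s * c" by (simp add: s_def sum_distrib_right)
    also have "\<dots> < (1 + s) * c" using c by simp
    also have "\<dots> = cmod (a j0 * poly p (l j0))" using s unfolding c_def by simp
    finally show False by simp
  qed
  with c show ?thesis by blast
qed

text \<open>The derivative that is large at \<open>x\<close> stays large over a length
  \<open>h\<close> independent of \<open>x\<close>, so \<open>sublevel_cover\<close> applies there.
  Its order depends on \<open>x\<close> but is below \<open>card I\<close>, hence the exponent
  \<open>card I\<close> and the constant \<open>6 ^ card I\<close> serve for all
  \<open>x\<close>.\<close>

lemma exp_sum_sublevel: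
  assumes I: "finite I" "inj_on \<tau> I" "j0 \<in> I" "a j0 \<noteq> 0"
  shows "\<exists>h>0. \<exists>c>0. \<exists>K>0. c \<le> 1 \<and> (\<forall>x e. 0 < e \<longrightarrow> e < 1 \<longrightarrow>
    emeasure lborel {y \<in> {x..x+h}. cmod (exp_sum I a \<tau> 0 y) \<le> c * e ^ card I} \<le> ennreal (K * e))"
proof -
  let ?E = "exp_sum I a \<tau>"
  obtain c0 where c0: "c0 > 0" and low: "\<And>y. \<exists>k<card I. c0 \<le> cmod (?E k y)"
    using exp_sum_derivs_lower[of I \<tau> j0 a] I by auto
  define B where "B = 1 + (\<Sum>k\<le>card I. \<Sum>j\<in>I. cmod (a j) * (2 * pi * \<bar>\<tau> j\<bar>) ^ k)"
  have B: "cmod (?E k y) \<le> B" if "k \<le> card I" for k y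
  proof -
    have "cmod (?E k y) \<le> (\<Sum>j\<in>I. cmod (a j) * (2 * pi * \<bar>\<tau> j\<bar>) ^ k)" by (rule norm_exp_sum_le)
    also have "\<dots> \<le> (\<Sum>k\<le>card I. \<Sum>j\<in>I. cmod (a j) * (2 * pi * \<bar>\<tau> j\<bar>) ^ k)"
      using that by (intro member_le_sum[of k _ "\<lambda>k. \<Sum>j\<in>I. cmod (a j) * (2 * pi * \<bar>\<tau> j\<bar>) ^ k"]) (auto intro!: sum_nonneg)
    finally show ?thesis unfolding B_def by simp
  qed
  have Bpos: "0 < B" unfolding B_def by (intro add_pos_nonneg sum_nonneg) auto
  \<comment> \<open>Over a length \<open>h\<close> a derivative of order below \<open>card I\<close>
    moves by at most \<open>h * B = c0 / 4\<close>, so a value of modulus at least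
    \<open>c0 / 2\<close> at \<open>x\<close> keeps modulus at least \<open>c0 / 4\<close>.\<close>
  define h where "h = c0 / (4 * B)"
  define c where "c = min 1 (c0 / 4)"
  have h: "0 < h" and c: "0 < c" "c \<le> 1" "c \<le> c0 / 4" using Bpos c0 by (auto simp: h_def c_def)
  have main: "emeasure lborel {y \<in> {x..x+h}. cmod (?E 0 y) \<le> c * e ^ card I} \<le> ennreal (6 ^ card I * e)"
    if e: "0 < e" "e < 1" for x e
  proof -
    obtain k where k: "k < card I" "c0 \<le> cmod (?E k x)" using low by blast
    \<comment> \<open>Passing to the real or the imaginary part makes the mean value theorem available.\<close>
    obtain w where w: "cmod w = 1" "c0 / 2 \<le> \<bar>Re (w * ?E k x)\<bar>"
    proof (cases "c0 / 2 \<le> \<bar>Re (?E k x)\<bar>")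
      case True
      then show ?thesis using that[of 1] by simp
    next
      case False
      moreover have "c0 \<le> \<bar>Re (?E k x)\<bar> + \<bar>Im (?E k x)\<bar>"
        using k cmod_le order_trans by blast
      ultimately show ?thesis using that[of \<i>] by simp
    qed
    define g where "g k y = Re (w * ?E k y)" for k y
    have der: "(g k has_real_derivative g (Suc k) y) (at y)" for k y
      unfolding g_def has_real_derivative_iff_has_vector_derivative
      by (intro bounded_linear.has_vector_derivative[OF bounded_linear_Re]
          has_vector_derivative_mult_right has_vector_derivative_exp_sum)
    have gB: "\<bar>g k y\<bar> \<le> B" if "k \<le> card I" for k y
      unfolding g_def using abs_Re_le_cmod[of "w * ?E k y"] B[OF that, of y] w(1) by (simp add: norm_mult)
    have lip: "\<bar>g k y - g k x\<bar> \<le> c0 / 4" if y: "y \<in> {x..x+h}" for y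
    proof (cases "x < y")
      case True
      obtain z where "g k y - g k x = (y - x) * g (Suc k) z"
        using MVT2[OF True, of "g k" "g (Suc k)"] der by blast
      then have "\<bar>g k y - g k x\<bar> \<le> h * B"
        using gB[of "Suc k" z] k True y by (auto simp: abs_mult intro!: mult_mono)
      then show ?thesis using Bpos by (simp add: h_def)
    next
      case False
      then have "y = x" using y by simp
      then show ?thesis using c0 by simp
    qed
    have big: "\<forall>y\<in>{x..x+h}. c \<le> \<bar>g k y\<bar>"
    proof
      fix y assume "y \<in> {x..x+h}"
      from lip[OF this] show "c \<le> \<bar>g k y\<bar>" using w(2) c unfolding g_def[symmetric] by linarith
    qed
    obtain S where S: "S \<in> sets lborel" "{y \<in> {x..x+h}. \<bar>g 0 y\<bar> \<le> c * e ^ Suc k} \<subseteq> S"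
      "emeasure lborel S \<le> ennreal (6 ^ k * e)"
      using sublevel_cover[of g e "{x..x+h}" c k, OF der e _ c(1) big] is_interval_cc by blast
    have "{y \<in> {x..x+h}. cmod (?E 0 y) \<le> c * e ^ card I} \<subseteq> {y \<in> {x..x+h}. \<bar>g 0 y\<bar> \<le> c * e ^ Suc k}"
    proof clarify
      fix y assume y: "cmod (?E 0 y) \<le> c * e ^ card I"
      have "\<bar>g 0 y\<bar> \<le> cmod (?E 0 y)"
        unfolding g_def using abs_Re_le_cmod[of "w * ?E 0 y"] w(1) by (simp add: norm_mult)
      also note y
      also have "c * e ^ card I \<le> c * e ^ Suc k"
        using k e c by (intro mult_left_mono power_decreasing) auto
      finally show "\<bar>g 0 y\<bar> \<le> c * e ^ Suc k" .
    qed
    then have "emeasure lborel {y \<in> {x..x+h}. cmod (?E 0 y) \<le> c * e ^ card I} \<le> emeasure lborel S"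
      using S by (intro emeasure_mono) auto
    also note S(3)
    also have "ennreal (6 ^ k * e) \<le> ennreal (6 ^ card I * e)"
      using k e by (intro ennreal_leI mult_right_mono power_increasing) auto
    finally show ?thesis .
  qed
  then show ?thesis using h c by (intro exI[of _ h] exI[of _ c] exI[of _ "6 ^ card I"] conjI allI impI) auto
qed

subsection \<open>The truncated logarithm\<close>

text \<open>The levels \<open>\<delta> N\<close> are those reached by \<open>sub\<close> with
  \<open>e = (1/2) ^ Suc N\<close>, where \<open>Suc\<close> keeps \<open>e\<close> below 1 even for
  \<open>N = 0\<close>. Between consecutive levels \<open>D\<close> grows only linearly in the index
  while the bound on the measure halves, so a geometric series dominates the sum over the
  layers.\<close>

lemma log_truncation_local:
  fixes A :: "real \<Rightarrow> complex"
  assumes meas: "A \<in> borel_measurable borel"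
    and c: "0 < c" "c \<le> 1" and K: "0 \<le> K" and n: "0 < n"
    and sub: "\<And>x e. 0 < e \<Longrightarrow> e < 1 \<Longrightarrow>
        emeasure lborel {y \<in> {x..x+h}. cmod (A y) \<le> c * e ^ n} \<le> ennreal (K * e)"
    and \<delta>: "\<And>N. \<delta> N = c * ((1/2) ^ Suc N) ^ n"
    and D: "\<And>N y. D N y = ln (max (cmod (A y)) (\<delta> N)) - ln (cmod (A y))"
  shows "\<exists>C\<ge>0. \<forall>N x. (\<integral>\<^sup>+y. indicator {x..x+h} y * ennreal (\<bar>D N y\<bar> + (D N y)\<^sup>2) \<partial>lborel)
            \<le> ennreal (C * (25/32) ^ N)"
proof -
  \<comment> \<open>Chosen so that \<open>C * (1 + real i)\<close> bounds the logarithms of both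
    \<open>\<delta> i\<close> and \<open>\<delta> (Suc i)\<close>; the 2 pays for the shift, as
    \<open>2 + real i \<le> 2 * (1 + real i)\<close>.\<close>
  define C where "C = 1 + \<bar>ln c\<bar> + 2 * real n"
  \<comment> \<open>Quadratic growth in \<open>i\<close> is replaced by a geometric one with ratio
    25/16, less than 2, so that it loses against the halving measures. The constants come from
    \<open>1 + real i \<le> 4 * (5/4) ^ i\<close>, squared and doubled.\<close>
  define w where "w i = 32 * C\<^sup>2 * (25/16) ^ i" for i :: nat
  have C: "1 \<le> C" unfolding C_def by simp
  have wpos: "0 \<le> w i" for i by (simp add: w_def)
  have \<delta>pos: "0 < \<delta> N" and \<delta>le: "\<delta> N \<le> 1" for N
  proof -
    show "0 < \<delta> N" using c \<delta> by simp
    have "c * ((1/2) ^ Suc N) ^ n \<le> 1 * 1"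
      using c by (intro mult_mono power_le_one) auto
    then show "\<delta> N \<le> 1" using \<delta> by simp
  qed
  have ln\<delta>: "\<bar>ln (\<delta> (Suc i))\<bar> \<le> C * (1 + real i)" "\<bar>ln (\<delta> i)\<bar> \<le> C * (1 + real i)" for i
  proof -
    have *: "\<bar>ln (\<delta> k)\<bar> \<le> \<bar>ln c\<bar> + real n * (1 + real k)" for k
    proof -
      have "ln (\<delta> k) = ln c - real n * (1 + real k) * ln 2"
        using c by (simp add: \<delta> ln_mult ln_realpow ln_div algebra_simps)
      moreover have "0 \<le> real n * (1 + real k) * ln 2" "real n * (1 + real k) * ln 2 \<le> real n * (1 + real k) * 1"
        using ln_2_less_1 by (simp, intro mult_left_mono) auto
      ultimately show ?thesis by linarith
    qed
    have "\<bar>ln c\<bar> + real n * (2 + real i) \<le> C * (1 + real i)"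
      unfolding C_def by (simp add: algebra_simps)
    then show "\<bar>ln (\<delta> (Suc i))\<bar> \<le> C * (1 + real i)" "\<bar>ln (\<delta> i)\<bar> \<le> C * (1 + real i)"
      using *[of i] *[of "Suc i"] mult_left_mono[of "1 + real i" "2 + real i" "real n"] by auto
  qed
  have wbound: "\<bar>u\<bar> + u\<^sup>2 \<le> w i" if "\<bar>u\<bar> \<le> C * (1 + real i)" for u i
  proof -
    define b where "b = C * (1 + real i)"
    have b1: "1 \<le> b" unfolding b_def using mult_mono[of 1 C 1 "1 + real i"] C by simp
    have "\<bar>u\<bar> + u\<^sup>2 \<le> b + b\<^sup>2"
      using that unfolding b_def[symmetric] by (intro add_mono) (auto intro: abs_le_square_iff[THEN iffD1])
    also have "\<dots> \<le> 2 * b\<^sup>2" using b1 by (simp add: power2_eq_square)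
    also have "b \<le> C * (4 * (5/4) ^ i)"
    proof -
      have "1 + real i * (1/4) \<le> (1 + 1/4) ^ i" by (rule Bernoulli_inequality) simp
      then show ?thesis unfolding b_def using C by (intro mult_left_mono) auto
    qed
    then have "2 * b\<^sup>2 \<le> 2 * (C * (4 * (5/4) ^ i))\<^sup>2"
      using b1 by (intro mult_left_mono power_mono) auto
    also have "\<dots> = 32 * C\<^sup>2 * ((5/4)\<^sup>2) ^ i"
      by (simp add: power_mult_distrib power_mult[symmetric] mult.commute)
    also have "\<dots> = w i" by (simp add: w_def power2_eq_square)
    finally show ?thesis .
  qed
  have ptw: "\<exists>i. cmod (A y) \<le> \<delta> (i + N) \<and> \<bar>D N y\<bar> + (D N y)\<^sup>2 \<le> w (i + N)" if "D N y \<noteq> 0" for N y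
  proof (cases "A y = 0")
    \<comment> \<open>At a zero of \<open>A\<close> the convention \<open>ln 0 = 0\<close> makes
      \<open>D N y\<close> equal to \<open>ln (\<delta> N)\<close>, so layer 0 suffices.\<close>
    case True
    then show ?thesis using \<delta>pos[of N] ln\<delta>[of N]
      by (intro exI[of _ 0] conjI) (auto simp: D intro!: wbound simp del: power2_abs)
  next
    case False
    have lt: "cmod (A y) < \<delta> N" using that by (cases "cmod (A y) = \<delta> N") (auto simp: D max_def split: if_splits)
    have "(\<lambda>i. \<delta> (i + N)) \<longlonglongrightarrow> 0"
    proof -
      have "\<delta> = (\<lambda>N. c * ((1/2) ^ n) ^ Suc N)"
        by (simp add: fun_eq_iff \<delta> power_mult[symmetric] power_mult_distrib mult.commute del: power_Suc)
      moreover have "(\<lambda>N. c * ((1/2::real) ^ n) ^ Suc N) \<longlonglongrightarrow> c * 0"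
        by (intro tendsto_intros LIMSEQ_Suc LIMSEQ_realpow_zero) (auto simp: n power_less_one_iff)
      ultimately have "\<delta> \<longlonglongrightarrow> 0" by simp
      then show ?thesis by (rule LIMSEQ_ignore_initial_segment)
    qed
    then have "\<forall>\<^sub>F i in sequentially. \<delta> (i + N) < cmod (A y)"
      using False by (intro order_tendstoD(2)) auto
    then obtain i0 where "\<delta> (i0 + N) < cmod (A y)" by (auto simp: eventually_sequentially)
    \<comment> \<open>Since \<open>cmod (A y) < \<delta> N\<close>, the first level below
      \<open>cmod (A y)\<close> has a predecessor, and these two levels bracket it.\<close>
    then obtain i where i: "\<not> \<delta> (i + N) < cmod (A y)" "\<delta> (Suc i + N) < cmod (A y)"
      using ex_least_nat_less[of "\<lambda>i. \<delta> (i + N) < cmod (A y)" i0] lt by fastforce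
    have "\<bar>D N y\<bar> \<le> \<bar>ln (\<delta> (Suc (i + N)))\<bar>"
    proof -
      have "ln (cmod (A y)) \<le> ln (\<delta> N)" using lt False \<delta>pos by (subst ln_le_cancel_iff) auto
      moreover have "ln (\<delta> (Suc (i + N))) \<le> ln (cmod (A y))"
        using i(2) \<delta>pos False by (subst ln_le_cancel_iff) auto
      moreover have "ln (\<delta> N) \<le> 0" using \<delta>le \<delta>pos by simp
      ultimately show ?thesis using lt by (simp add: D)
    qed
    then show ?thesis using i ln\<delta>(1)[of "i + N"] by (intro exI[of _ i] conjI wbound) auto
  qed
  have main: "(\<integral>\<^sup>+y. indicator {x..x+h} y * ennreal (\<bar>D N y\<bar> + (D N y)\<^sup>2) \<partial>lborel)
      \<le> ennreal (16 * C\<^sup>2 * K * (32/7) * (25/32) ^ N)" for N x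
  proof -
    let ?S = "\<lambda>i. {y \<in> {x..x+h}. cmod (A y) \<le> \<delta> (i + N)}"
    have S: "?S i \<in> sets lborel" for i using meas by simp
    \<comment> \<open>Pointwise one term of the series is enough; summing over all sublevel sets
      removes the dependence of \<open>i\<close> on \<open>y\<close>.\<close>
    have "indicator {x..x+h} y * ennreal (\<bar>D N y\<bar> + (D N y)\<^sup>2)
        \<le> suminf (\<lambda>i. ennreal (w (i + N)) * indicator (?S i) y)" (is "_ \<le> suminf ?f") for y
    proof (cases "y \<in> {x..x+h} \<and> D N y \<noteq> 0")
      case True
      then obtain i where i: "cmod (A y) \<le> \<delta> (i + N)" "\<bar>D N y\<bar> + (D N y)\<^sup>2 \<le> w (i + N)"
        using ptw by blast
      have "indicator {x..x+h} y * ennreal (\<bar>D N y\<bar> + (D N y)\<^sup>2) \<le> ?f i"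
        using True i by (auto intro!: ennreal_leI simp del: ennreal_plus)
      also have "\<dots> \<le> suminf ?f"
        using sum_le_suminf[of ?f "{i}"] by (simp del: indicator_simps mem_Collect_eq sum_mult_indicator)
      finally show ?thesis .
    qed auto
    then have "(\<integral>\<^sup>+y. indicator {x..x+h} y * ennreal (\<bar>D N y\<bar> + (D N y)\<^sup>2) \<partial>lborel)
        \<le> (\<integral>\<^sup>+y. (suminf (\<lambda>i. ennreal (w (i + N)) * indicator (?S i) y)) \<partial>lborel)"
      by (intro nn_integral_mono) auto
    also have "\<dots> = (suminf (\<lambda>i. ennreal (w (i + N)) * emeasure lborel (?S i)))"
      using S by (subst nn_integral_suminf) (auto simp: nn_integral_cmult_indicator)
    also have "\<dots> \<le> (suminf (\<lambda>i. ennreal (16 * C\<^sup>2 * K * (25/32) ^ N * (25/32) ^ i)))"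
    proof (intro suminf_le)
      fix i
      have "ennreal (w (i + N)) * emeasure lborel (?S i) \<le> ennreal (w (i + N)) * ennreal (K * (1/2) ^ Suc (i + N))"
        unfolding \<delta> by (intro mult_left_mono sub) (auto simp: power_less_one_iff simp del: power_Suc)
      also have "\<dots> = ennreal (w (i + N) * (K * (1/2) ^ Suc (i + N)))"
        using wpos K by (subst ennreal_mult) auto
      also have "w (i + N) * (K * (1/2) ^ Suc (i + N)) = 16 * C\<^sup>2 * K * ((25/16) ^ (i + N) * (1/2) ^ (i + N))"
        by (simp add: w_def)
      also have "(25/16) ^ (i + N) * (1/2) ^ (i + N) = (25/32 :: real) ^ (i + N)"
        by (simp flip: power_mult_distrib)
      finally show "ennreal (w (i + N)) * emeasure lborel (?S i) \<le> ennreal (16 * C\<^sup>2 * K * (25/32) ^ N * (25/32) ^ i)"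
        by (simp add: power_add ac_simps)
    qed auto
    also have "\<dots> = ennreal (suminf (\<lambda>i. 16 * C\<^sup>2 * K * (25/32) ^ N * (25/32) ^ i))"
      using K by (intro suminf_ennreal2) (auto intro!: summable_mult summable_geometric)
    \<comment> \<open>The geometric series with ratio 25/32 sums to 32/7.\<close>
    also have "(suminf (\<lambda>i. 16 * C\<^sup>2 * K * (25/32) ^ N * (25/32) ^ i)) = 16 * C\<^sup>2 * K * (32/7) * (25/32) ^ N"
      by (subst suminf_mult) (auto simp: suminf_geometric summable_geometric)
    finally show ?thesis .
  qed
  show ?thesis
    by (rule exI[of _ "16 * C\<^sup>2 * K * (32/7)"]) (use main K in auto)
qed

text \<open>\<open>Suc q\<close> consecutive intervals of length \<open>h\<close> cover
  \<open>{-L..L}\<close>. The last one may stick out, which the factor 2 pays for since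
  \<open>h \<le> 2 * L\<close>.\<close>

lemma nn_integral_symmetric_interval_le:
  fixes f :: "real \<Rightarrow> ennreal"
  assumes f: "f \<in> borel_measurable borel" and h: "0 < h" "h \<le> 2 * L" and T: "0 \<le> T"
    and le: "\<And>x. (\<integral>\<^sup>+y. indicator {x..x+h} y * f y \<partial>lborel) \<le> ennreal T"
  shows "(\<integral>\<^sup>+y. indicator {-L..L} y * f y \<partial>lborel) \<le> ennreal (2 * L * (2 * T / h))"
proof -
  define q where "q = nat \<lfloor>2 * L / h\<rfloor>"
  have "indicator {-L..L} y * f y \<le> (\<Sum>k<Suc q. indicator {-L + real k * h .. -L + real k * h + h} y * f y)" for y
  proof (cases "y \<in> {-L..L}")
    case True
    define k where "k = nat \<lfloor>(y + L) / h\<rfloor>"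
    have k0: "0 \<le> (y + L) / h" using True h by simp
    then have k: "real k \<le> (y + L) / h" "(y + L) / h \<le> real k + 1"
      unfolding k_def by linarith+
    have "(y + L) / h \<le> 2 * L / h" using True h by (simp add: divide_right_mono)
    then have kq: "k < Suc q" unfolding k_def q_def using k0 by linarith
    have "y \<in> {-L + real k * h .. -L + real k * h + h}"
      using k h by (auto simp: field_simps)
    then have "indicator {-L..L} y * f y \<le> indicator {-L + real k * h .. -L + real k * h + h} y * f y"
      using True by simp
    also have "\<dots> \<le> (\<Sum>k<Suc q. indicator {-L + real k * h .. -L + real k * h + h} y * f y)"
      using kq by (intro member_le_sum) auto
    finally show ?thesis .
  qed simp
  then have "(\<integral>\<^sup>+y. indicator {-L..L} y * f y \<partial>lborel)
      \<le> (\<integral>\<^sup>+y. (\<Sum>k<Suc q. indicator {-L + real k * h .. -L + real k * h + h} y * f y) \<partial>lborel)"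
    by (intro nn_integral_mono) auto
  also have "\<dots> = (\<Sum>k<Suc q. \<integral>\<^sup>+y. indicator {-L + real k * h .. -L + real k * h + h} y * f y \<partial>lborel)"
    using f by (intro nn_integral_sum) auto
  also have "\<dots> \<le> (\<Sum>k<Suc q. ennreal T)" by (intro sum_mono le)
  also have "\<dots> = ennreal (real (Suc q) * T)" using T by (simp add: ennreal_mult ennreal_of_nat_eq_real_of_nat)
  also have "\<dots> \<le> ennreal (2 * L * (2 * T / h))"
  proof (rule ennreal_leI)
    have "1 \<le> 2 * L / h" using h by simp
    then have "real (Suc q) \<le> 2 * (2 * L / h)" unfolding q_def by linarith
    then have "real (Suc q) * T \<le> 2 * (2 * L / h) * T" using T by (rule mult_right_mono)
    then show "real (Suc q) * T \<le> 2 * L * (2 * T / h)" by (simp add: algebra_simps)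
  qed
  finally show ?thesis .
qed

text \<open>Packages the sublevel, layer and covering estimates so that all that survives is a null
  sequence \<open>T\<close> bounding the mean truncation errors.\<close>

lemma exp_sum_log_truncation:
  assumes I: "finite I" "inj_on \<tau> I" "j0 \<in> I" "a j0 \<noteq> 0"
  obtains \<delta> T :: "nat \<Rightarrow> real" and h :: real
  where "0 < h" "\<And>N. 0 < \<delta> N" "decseq \<delta>" "\<delta> \<longlonglongrightarrow> 0" "\<And>N. 0 \<le> T N" "T \<longlonglongrightarrow> 0"
    "\<And>N L. h \<le> L \<Longrightarrow> (\<integral>\<^sup>+y. indicator {-L..L} y *
        ennreal (\<bar>ln (max (cmod (exp_sum I a \<tau> 0 y)) (\<delta> N)) - ln (cmod (exp_sum I a \<tau> 0 y))\<bar> +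
          (ln (max (cmod (exp_sum I a \<tau> 0 y)) (\<delta> N)) - ln (cmod (exp_sum I a \<tau> 0 y)))\<^sup>2) \<partial>lborel)
        \<le> ennreal (2 * L * T N)"
proof -
  let ?A = "exp_sum I a \<tau> 0"
  have n: "0 < card I" using I card_gt_0_iff by blast
  obtain h c K where hcK: "0 < h" "0 < c" "0 < K" "c \<le> 1"
    and sub: "\<And>x e. 0 < e \<Longrightarrow> e < 1 \<Longrightarrow>
      emeasure lborel {y \<in> {x..x+h}. cmod (?A y) \<le> c * e ^ card I} \<le> ennreal (K * e)"
    using exp_sum_sublevel[of I \<tau> j0 a] I by blast
  define \<delta> where "\<delta> N = c * ((1/2) ^ Suc N) ^ card I" for N
  define D where "D N y = ln (max (cmod (?A y)) (\<delta> N)) - ln (cmod (?A y))" for N y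
  have "continuous_on UNIV ?A"
    unfolding exp_sum_def by (intro continuous_intros)
  then have [measurable]: "?A \<in> borel_measurable borel"
    by (rule borel_measurable_continuous_onI)
  obtain C where C: "0 \<le> C" "\<And>N x. (\<integral>\<^sup>+y. indicator {x..x+h} y * ennreal (\<bar>D N y\<bar> + (D N y)\<^sup>2) \<partial>lborel)
            \<le> ennreal (C * (25/32) ^ N)"
    using log_truncation_local[of ?A c K "card I" h \<delta> D] hcK n sub by (auto simp: \<delta>_def D_def)
  have [measurable]: "D N \<in> borel_measurable borel" for N
    unfolding D_def by measurable
  have trunc: "(\<integral>\<^sup>+y. indicator {-L..L} y * ennreal (\<bar>D N y\<bar> + (D N y)\<^sup>2) \<partial>lborel)
      \<le> ennreal (2 * L * (2 * (C * (25/32) ^ N) / h))" if "h \<le> L" for N L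
    by (rule nn_integral_symmetric_interval_le) (use C hcK that in auto)
  have \<delta>': "\<delta> = (\<lambda>N. c * ((1/2) ^ card I) ^ Suc N)"
    by (simp add: fun_eq_iff \<delta>_def power_mult[symmetric] mult.commute del: power_Suc)
  show ?thesis
  proof (rule that[of h \<delta> "\<lambda>N. 2 * (C * (25/32) ^ N) / h"])
    show "decseq \<delta>"
      unfolding decseq_def \<delta>' using hcK
      by (intro allI impI mult_left_mono power_decreasing) (auto simp: power_le_one)
    have "(\<lambda>N. c * ((1/2::real) ^ card I) ^ Suc N) \<longlonglongrightarrow> c * 0"
      by (intro tendsto_intros LIMSEQ_Suc LIMSEQ_realpow_zero) (use n in \<open>auto simp: power_less_one_iff\<close>)
    then show "\<delta> \<longlonglongrightarrow> 0" by (simp add: \<delta>')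
    have "(\<lambda>N. 2 * (C * (25/32) ^ N) / h) \<longlonglongrightarrow> 2 * (C * 0) / h"
      using hcK by (intro tendsto_intros LIMSEQ_realpow_zero) auto
    then show "(\<lambda>N. 2 * (C * (25/32) ^ N) / h) \<longlonglongrightarrow> 0" by simp
  qed (use hcK C trunc in \<open>auto simp: \<delta>_def D_def\<close>)
qed

subsection \<open>Trigonometric polynomials on the torus\<close>

text \<open>The unit cube as a probability space; opposite faces are not identified, which does not
  affect integrals. It turns the set integral in \<open>mahler_measure\<close> into a plain
  one.\<close>

definition torus :: "nat \<Rightarrow> (nat \<Rightarrow> real) measure" where
  "torus d = restrict_space (\<Pi>\<^sub>M i\<in>{1..d}. lborel) ({1..d} \<rightarrow>\<^sub>E {0..1})"

text \<open>Trigonometric polynomials in the angles \<open>t\<close>, generated so that linear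
  statements need checking on monomials only. The argument is an arbitrary function, so points of
  the cube and points \<open>\<lambda>i. r i * y\<close> of a line can both be inserted.\<close>

inductive torus_poly :: "nat \<Rightarrow> ((nat \<Rightarrow> real) \<Rightarrow> complex) \<Rightarrow> bool" for d where
  monomial: "torus_poly d (\<lambda>t. c * e2pi (\<Sum>i\<in>{1..d}. of_int (\<alpha> i) * t i))"
| add: "torus_poly d F \<Longrightarrow> torus_poly d G \<Longrightarrow> torus_poly d (\<lambda>t. F t + G t)"

lemma e2pi_add: "e2pi (x + y) = e2pi x * e2pi y"
  by (simp add: exp_add[symmetric] algebra_simps)

lemma e2pi_0: "e2pi 0 = 1" by simp

lemma e2pi_sum: "finite I \<Longrightarrow> e2pi (\<Sum>i\<in>I. f i) = (\<Prod>i\<in>I. e2pi (f i))"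
  by (induction I rule: finite_induct) (simp_all only: sum.empty prod.empty e2pi_0 sum.insert prod.insert e2pi_add not_False_eq_True)

lemma e2pi_powi: "e2pi x powi n = e2pi (of_int n * x)"
  by (cases n rule: int_cases2) (simp_all add: power_int_minus exp_of_nat_mult[symmetric] exp_minus[symmetric] algebra_simps)

lemma torus_poly_const: "torus_poly d (\<lambda>t. c)"
  using torus_poly.monomial[of d c "\<lambda>_. 0"] by simp

lemma torus_poly_sum:
  "finite I \<Longrightarrow> (\<And>i. i \<in> I \<Longrightarrow> torus_poly d (F i)) \<Longrightarrow> torus_poly d (\<lambda>t. \<Sum>i\<in>I. F i t)"
  by (induction I rule: finite_induct) (auto intro: torus_poly_const torus_poly.add)

lemma torus_poly_mult:
  assumes "torus_poly d F" "torus_poly d G"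
  shows "torus_poly d (\<lambda>t. F t * G t)"
  using assms(1)
proof induction
  case (monomial c \<alpha>)
  show ?case using assms(2)
  proof induction
    case (monomial b \<beta>)
    have "(\<lambda>t. c * e2pi (\<Sum>i\<in>{1..d}. of_int (\<alpha> i) * t i) * (b * e2pi (\<Sum>i\<in>{1..d}. of_int (\<beta> i) * t i)))
        = (\<lambda>t. c * b * e2pi (\<Sum>i\<in>{1..d}. of_int (\<alpha> i + \<beta> i) * t i))"
      by (simp add: e2pi_add sum.distrib distrib_right fun_eq_iff del: of_real_sum of_real_add)
    then show ?case by (simp only: torus_poly.monomial)
  next
    case (add F G)
    then show ?case by (simp add: distrib_left torus_poly.add)
  qed
next
  case (add F G)
  then show ?case by (simp add: distrib_right torus_poly.add)
qed

lemma cnj_e2pi: "cnj (e2pi x) = e2pi (- x)"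
  by (simp add: exp_cnj)

lemma torus_poly_cnj: "torus_poly d F \<Longrightarrow> torus_poly d (\<lambda>t. cnj (F t))"
proof (induction rule: torus_poly.induct)
  case (monomial c \<alpha>)
  have "(\<lambda>t. cnj (c * e2pi (\<Sum>i\<in>{1..d}. of_int (\<alpha> i) * t i)))
        = (\<lambda>t. cnj c * e2pi (\<Sum>i\<in>{1..d}. of_int (- \<alpha> i) * t i))"
    by (simp only: complex_cnj_mult cnj_e2pi of_int_minus mult_minus_left sum_negf)
  then show ?case by (simp only: torus_poly.monomial)
qed (auto intro: torus_poly.add)

lemma torus_poly_power: "torus_poly d F \<Longrightarrow> torus_poly d (\<lambda>t. F t ^ n)"
  by (induction n) (auto intro: torus_poly_const torus_poly_mult)

lemma torus_poly_laurent_eval: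
  assumes "laurent_in d P"
  shows "torus_poly d (\<lambda>t. laurent_eval P (\<lambda>i. e2pi (t i)))"
  unfolding laurent_eval_def
proof (intro torus_poly_sum finite_keys)
  fix \<alpha> assume "\<alpha> \<in> Poly_Mapping.keys P"
  then have k: "Poly_Mapping.keys \<alpha> \<subseteq> {1..d}" using assms by (auto simp: laurent_in_def)
  have "(\<Prod>i\<in>Poly_Mapping.keys \<alpha>. e2pi (t i) powi Poly_Mapping.lookup \<alpha> i)
      = e2pi (\<Sum>i\<in>{1..d}. of_int (Poly_Mapping.lookup \<alpha> i) * t i)" for t
  proof -
    have "(\<Prod>i\<in>Poly_Mapping.keys \<alpha>. e2pi (t i) powi Poly_Mapping.lookup \<alpha> i)
      = (\<Prod>i\<in>{1..d}. e2pi (t i) powi Poly_Mapping.lookup \<alpha> i)"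
      \<comment> \<open>Outside its keys the exponent is 0 and the factor 1, so the product may run
        over all variables.\<close>
      using k by (intro prod.mono_neutral_left) (auto simp: in_keys_iff)
    then show ?thesis unfolding e2pi_powi by (simp only: e2pi_sum finite_atLeastAtMost)
  qed
  then show "torus_poly d (\<lambda>t. Poly_Mapping.lookup P \<alpha> *
      (\<Prod>i\<in>Poly_Mapping.keys \<alpha>. e2pi (t i) powi Poly_Mapping.lookup \<alpha> i))"
    by (simp only: torus_poly.monomial)
qed

lemma torus_poly_measurable: "torus_poly d F \<Longrightarrow> F \<in> borel_measurable (torus d)"
proof (induction rule: torus_poly.induct)
  case (monomial c \<alpha>)
  have "(\<lambda>t. c * e2pi (\<Sum>i\<in>{1..d}. of_int (\<alpha> i) * t i)) \<in> borel_measurable (\<Pi>\<^sub>M i\<in>{1..d}. lborel)"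
    by measurable
  then show ?case unfolding torus_def by (rule measurable_restrict_space1)
qed auto

lemma torus_poly_bounded: "torus_poly d F \<Longrightarrow> \<exists>B. \<forall>t. cmod (F t) \<le> B"
proof (induction rule: torus_poly.induct)
  case (monomial c \<alpha>)
  then show ?case by (intro exI[of _ "cmod c"]) (simp add: norm_mult)
next
  case (add F G)
  then show ?case by (meson add_mono norm_triangle_le)
qed

section \<open>Restriction of torus polynomials to a line\<close>

lemma torus_poly_continuous_line: "torus_poly d F \<Longrightarrow> continuous_on X (\<lambda>y. F (\<lambda>i. r i * y))"
  by (induction rule: torus_poly.induct) (auto intro!: continuous_intros)

lemma trig_poly_add: "trig_poly F \<Longrightarrow> trig_poly G \<Longrightarrow> trig_poly (\<lambda>y. F y + G y)"
proof -
  assume "trig_poly F" "trig_poly G"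
  then obtain n b s n' b' s' where F: "F = (\<lambda>y. \<Sum>k<n::nat. b k * e2pi (s k * y))"
    and G: "G = (\<lambda>y. \<Sum>k<n'::nat. b' k * e2pi (s' k * y))"
    unfolding trig_poly_def by blast
  \<comment> \<open>The second family of terms is appended to the first, with its indices shifted by
    \<open>n\<close>.\<close>
  let ?b = "\<lambda>k. if k < n then b k else b' (k - n)"
  let ?s = "\<lambda>k. if k < n then s k else s' (k - n)"
  have "F y + G y = (\<Sum>k<n+n'. ?b k * e2pi (?s k * y))" for y
  proof -
    have "(\<Sum>k\<in>{n..<n+n'}. ?b k * e2pi (?s k * y)) = G y"
      unfolding G using sum.shift_bounds_nat_ivl[of "\<lambda>k. ?b k * e2pi (?s k * y)" 0 n n']
      by (simp add: add.commute lessThan_atLeast0)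
    moreover have "(\<Sum>k<n. ?b k * e2pi (?s k * y)) = F y" unfolding F by simp
    moreover have "(\<Sum>k<n+n'. ?b k * e2pi (?s k * y))
      = (\<Sum>k<n. ?b k * e2pi (?s k * y)) + (\<Sum>k\<in>{n..<n+n'}. ?b k * e2pi (?s k * y))"
      unfolding lessThan_atLeast0 by (rule sum.atLeastLessThan_concat[symmetric]) auto
    ultimately show ?thesis by simp
  qed
  then have "(\<lambda>y. F y + G y) = (\<lambda>y. \<Sum>k<n+n'. ?b k * e2pi (?s k * y))" by blast
  then show "trig_poly (\<lambda>y. F y + G y)" unfolding trig_poly_def
    by (intro exI[of _ "n + n'"] exI[of _ ?b] exI[of _ ?s])
qed

lemma torus_poly_trig_poly_line: "torus_poly d F \<Longrightarrow> trig_poly (\<lambda>y. F (\<lambda>i. r i * y))"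
proof (induction rule: torus_poly.induct)
  case (monomial c \<alpha>)
  show ?case unfolding trig_poly_def
    by (intro exI[of _ 1] exI[of _ "\<lambda>_. c"] exI[of _ "\<lambda>_. \<Sum>i\<in>{1..d}. of_int (\<alpha> i) * r i"])
       (simp add: fun_eq_iff sum_distrib_right mult.assoc)
qed (rule trig_poly_add)

section \<open>The torus as a measure space\<close>

lemma space_torus: "space (torus d) = {1..d} \<rightarrow>\<^sub>E {0..1}"
  unfolding torus_def by (auto simp: space_restrict_space space_PiM PiE_def)

lemma PiE_unit_sets: "({1..d} \<rightarrow>\<^sub>E {0..1::real}) \<in> sets (\<Pi>\<^sub>M i\<in>{1..d::nat}. lborel)"
  by (intro sets_PiM_I_finite) auto

lemma emeasure_torus: "emeasure (torus d) (space (torus d)) = 1"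
proof -
  interpret product_sigma_finite "\<lambda>_::nat. lborel :: real measure" by standard
  show ?thesis unfolding space_torus
    unfolding torus_def using PiE_unit_sets[of d]
    by (subst emeasure_restrict_space) (auto simp: emeasure_PiM)
qed

lemma finite_measure_torus: "finite_measure (torus d)"
  by standard (simp add: emeasure_torus)

lemma integral_torus:
  fixes f :: "(nat \<Rightarrow> real) \<Rightarrow> 'b::{banach, second_countable_topology}"
  shows "(LINT t|torus d. f t) = (LINT t : ({1..d} \<rightarrow>\<^sub>E {0..1}) | (\<Pi>\<^sub>M i\<in>{1..d}. lborel). f t)"
  unfolding torus_def set_lebesgue_integral_def
  using PiE_unit_sets[of d] by (subst integral_restrict_space) (auto intro!: sets.Int)

section \<open>Integrals and means of single exponentials\<close>

lemma LBINT_e2pi: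
  assumes "s \<noteq> 0" "a \<le> b"
  shows "(LINT y:{a..b}|lborel. e2pi (s * y)) = (e2pi (s * b) - e2pi (s * a)) / (2 * complex_of_real pi * \<i> * complex_of_real s)"
proof -
  have "(LINT y:{a..b}|lborel. e2pi (s * y)) =
     e2pi (s * b) / (2 * complex_of_real pi * \<i> * complex_of_real s) - e2pi (s * a) / (2 * complex_of_real pi * \<i> * complex_of_real s)"
    unfolding set_lebesgue_integral_def
  proof (rule integral_FTC_atLeastAtMost[OF assms(2)])
    fix y :: real
    have "((\<lambda>y. e2pi (s * y) * inverse (2 * complex_of_real pi * \<i> * complex_of_real s)) has_vector_derivative
      2 * complex_of_real pi * \<i> * complex_of_real s * e2pi (s * y) * inverse (2 * complex_of_real pi * \<i> * complex_of_real s)) (at y within {a..b})"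
      by (intro has_vector_derivative_mult_left has_vector_derivative_e2pi)
    then show "((\<lambda>y. e2pi (s * y) / (2 * complex_of_real pi * \<i> * complex_of_real s)) has_vector_derivative
      e2pi (s * y)) (at y within {a..b})" using assms(1) by (simp add: field_simps)
  qed (auto intro!: continuous_intros)
  then show ?thesis by (simp add: diff_divide_distrib)
qed

text \<open>Orthogonality of characters: the integral factors into one-dimensional ones, each over
  full periods and hence zero unless its exponent is 0.\<close>

lemma integral_torus_monomial:
  "(LINT t|torus d. e2pi (\<Sum>i\<in>{1..d}. of_int (\<alpha> i) * t i)) = (if \<forall>i\<in>{1..d}. \<alpha> i = 0 then 1 else 0)"
proof -
  interpret product_sigma_finite "\<lambda>_::nat. lborel :: real measure" by standard
  have one: "(LINT y:{0..1}|lborel. e2pi (of_int n * y)) = (if n = 0 then 1 else 0)" for n :: int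
  proof (cases "n = 0")
    case False
    have "e2pi (of_int n) = 1"
      using exp_integer_2pi[of "of_int n"] by (simp add: mult_ac)
    then show ?thesis using False LBINT_e2pi[of "of_int n" 0 1] by simp
  qed (simp add: set_lebesgue_integral_def)
  have "(LINT t|torus d. e2pi (\<Sum>i\<in>{1..d}. of_int (\<alpha> i) * t i))
      = (\<integral>t. (\<Prod>i\<in>{1..d}. indicator {0..1} (t i) *\<^sub>R e2pi (of_int (\<alpha> i) * t i)) \<partial>(\<Pi>\<^sub>M i\<in>{1..d}. lborel))"
    unfolding integral_torus set_lebesgue_integral_def
  proof (intro Bochner_Integration.integral_cong refl)
    fix t :: "nat \<Rightarrow> real" assume t: "t \<in> space (\<Pi>\<^sub>M i\<in>{1..d}. lborel)"
    \<comment> \<open>The cube must also be factored. A point of the product space is already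
      extensional, so it can miss the cube only by a coordinate outside the unit interval.\<close>
    have "indicator ({1..d} \<rightarrow>\<^sub>E {0..1}) t = (\<Prod>i\<in>{1..d}. indicator {0..1} (t i) :: real)"
    proof (cases "t \<in> {1..d} \<rightarrow>\<^sub>E {0..1}")
      case True
      then have "(\<Prod>i\<in>{1..d}. indicator {0..1} (t i) :: real) = 1"
        by (intro prod.neutral) (auto simp: PiE_def Pi_def)
      then show ?thesis using True by simp
    next
      case False
      then obtain i where i: "i \<in> {1..d}" "t i \<notin> {0..1}" using t unfolding space_PiM PiE_def Pi_def by blast
      then have "(\<Prod>i\<in>{1..d}. indicator {0..1} (t i) :: real) = 0"
        by (intro prod_zero bexI[of _ i]) auto
      then show ?thesis using False by simp
    qed
    then show "indicator ({1..d} \<rightarrow>\<^sub>E {0..1}) t *\<^sub>R e2pi (\<Sum>i\<in>{1..d}. of_int (\<alpha> i) * t i)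
      = (\<Prod>i\<in>{1..d}. indicator {0..1} (t i) *\<^sub>R e2pi (of_int (\<alpha> i) * t i))"
      by (simp only: e2pi_sum finite_atLeastAtMost scaleR_conv_of_real of_real_prod prod.distrib)
  qed
  also have "\<dots> = (\<Prod>i\<in>{1..d}. LINT y:{0..1}|lborel. e2pi (of_int (\<alpha> i) * y))"
    unfolding set_lebesgue_integral_def
    by (intro product_integral_prod)
       (auto intro!: borel_integrable_compact continuous_intros)
  also have "\<dots> = (if \<forall>i\<in>{1..d}. \<alpha> i = 0 then 1 else 0)"
    unfolding one by (auto intro!: prod.neutral prod_zero)
  finally show ?thesis .
qed

text \<open>For nonzero \<open>s\<close> the explicit primitive keeps the integral bounded in
  \<open>L\<close>, so division by \<open>2 * L\<close> sends it to 0.\<close>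

lemma mean_e2pi:
  "((\<lambda>L. (LINT y:{-L..L}|lborel. e2pi (s * y)) / complex_of_real (2 * L)) \<longlongrightarrow> (if s = 0 then 1 else 0)) at_top"
proof (cases "s = 0")
  case True
  have "\<forall>\<^sub>F L :: real in at_top. (LINT y:{-L..L}|lborel. e2pi (s * y)) / complex_of_real (2 * L) = 1"
    using eventually_gt_at_top[of "0::real"]
    by eventually_elim (simp add: True set_lebesgue_integral_def scaleR_conv_of_real)
  then show ?thesis using True by (simp add: tendsto_eventually)
next
  case False
  have "((\<lambda>L. (LINT y:{-L..L}|lborel. e2pi (s * y)) / complex_of_real (2 * L)) \<longlongrightarrow> 0) at_top"
  proof (rule Lim_null_comparison)
    show "\<forall>\<^sub>F L in at_top. cmod ((LINT y:{-L..L}|lborel. e2pi (s * y)) / complex_of_real (2 * L))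
        \<le> (1 / (2 * pi * \<bar>s\<bar>)) * inverse L"
      using eventually_gt_at_top[of "0::real"]
    proof eventually_elim
      case (elim L)
      have "cmod (e2pi (s * L) - e2pi (s * - L)) \<le> 2"
        using norm_triangle_ineq4[of "e2pi (s * L)" "e2pi (s * - L)"] by (simp only: norm_e2pi)
      then have "cmod (e2pi (s * L) - e2pi (s * - L)) / (2 * pi * \<bar>s\<bar>) / (2 * L) \<le> 2 / (2 * pi * \<bar>s\<bar>) / (2 * L)"
        using elim by (intro divide_right_mono) auto
      moreover have "cmod ((LINT y:{-L..L}|lborel. e2pi (s * y)) / complex_of_real (2 * L))
         = cmod (e2pi (s * L) - e2pi (s * - L)) / (2 * pi * \<bar>s\<bar>) / (2 * L)"
        using elim False by (subst LBINT_e2pi) (auto simp: norm_divide norm_mult)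
      ultimately show ?case using elim by (simp add: field_simps)
    qed
    show "((\<lambda>L. (1 / (2 * pi * \<bar>s\<bar>)) * inverse L) \<longlongrightarrow> 0) at_top"
      by (intro tendsto_mult_right_zero tendsto_inverse_0_at_top filterlim_ident)
  qed
  then show ?thesis using False by simp
qed

section \<open>Rational independence and equidistribution\<close>

interpretation rat_real: vector_space "\<lambda>q :: rat. (*) (real_of_rat q)"
  by (rule vector_space_rat_real)

lemma rat_independent_int_combination:
  assumes "inj_on r I" "rat_independent (r ` I)" "finite I"
    and "(\<Sum>i\<in>I. of_int (\<alpha> i) * r i) = 0" "i \<in> I"
  shows "\<alpha> i = (0::int)"
proof (rule ccontr)
  assume "\<alpha> i \<noteq> 0"
  \<comment> \<open>The integer exponents become rational coefficients on the image of
    \<open>I\<close>; injectivity of \<open>r\<close> makes this well defined.\<close>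
  let ?u = "\<lambda>v. of_int (\<alpha> (the_inv_into I r v)) :: rat"
  have "(\<Sum>v\<in>r ` I. real_of_rat (?u v) * v) = (\<Sum>i\<in>I. of_int (\<alpha> i) * r i)"
    using assms by (simp add: sum.reindex the_inv_into_f_f)
  moreover have "?u (r i) \<noteq> 0" using assms \<open>\<alpha> i \<noteq> 0\<close> by (simp add: the_inv_into_f_f)
  ultimately have "rat_real.dependent (r ` I)"
    using assms(3,5) by (subst rat_real.dependent_finite) (use assms(4) in \<open>auto intro!: exI[of _ ?u]\<close>)
  with assms(2) show False by simp
qed

lemma torus_poly_integrable: 
  assumes "torus_poly d F" shows "integrable (torus d) F"
proof -
  interpret finite_measure "torus d" by (rule finite_measure_torus)
  obtain B where "\<forall>t. cmod (F t) \<le> B" using torus_poly_bounded[OF assms] by blast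
  then show ?thesis by (intro integrable_const_bound[of _ B] torus_poly_measurable assms) auto
qed

text \<open>Kronecker-Weyl equidistribution. Both sides are linear, and for a monomial the frequency
  along the line vanishes exactly when all exponents do, by rational independence.\<close>

lemma torus_poly_mean:
  assumes r: "inj_on r {1..d}" "rat_independent (r ` {1..d})"
    and F: "torus_poly d F"
  shows "((\<lambda>L. (LINT y:{-L..L}|lborel. F (\<lambda>i. r i * y)) / complex_of_real (2 * L)) \<longlongrightarrow> (LINT t|torus d. F t)) at_top"
  using F
proof induction
  case (monomial c \<alpha>)
  let ?s = "\<Sum>i\<in>{1..d}. of_int (\<alpha> i) * r i"
  have "?s = 0 \<longleftrightarrow> (\<forall>i\<in>{1..d}. \<alpha> i = 0)"
    using rat_independent_int_combination[OF r, of \<alpha>] by auto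
  then have "(LINT t|torus d. c * e2pi (\<Sum>i\<in>{1..d}. of_int (\<alpha> i) * t i)) = c * (if ?s = 0 then 1 else 0)"
    by (simp only: integral_mult_right_zero integral_torus_monomial)
  moreover have "(LINT y:{-L..L}|lborel. c * e2pi (\<Sum>i\<in>{1..d}. of_int (\<alpha> i) * (r i * y))) / complex_of_real (2 * L)
     = c * ((LINT y:{-L..L}|lborel. e2pi (?s * y)) / complex_of_real (2 * L))" for L
    by (simp only: set_integral_mult_right sum_distrib_right mult.assoc times_divide_eq_right)
  ultimately show ?case
    by (simp only:) (intro tendsto_mult tendsto_const mean_e2pi)
next
  case (add F G)
  have "set_integrable lborel {-L..L} (\<lambda>y. F (\<lambda>i. r i * y))" "set_integrable lborel {-L..L} (\<lambda>y. G (\<lambda>i. r i * y))" for L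
    using add torus_poly_continuous_line by (auto intro!: borel_integrable_atLeastAtMost')
  then have "(LINT y:{-L..L}|lborel. F (\<lambda>i. r i * y) + G (\<lambda>i. r i * y)) / complex_of_real (2 * L)
      = (LINT y:{-L..L}|lborel. F (\<lambda>i. r i * y)) / complex_of_real (2 * L)
      + (LINT y:{-L..L}|lborel. G (\<lambda>i. r i * y)) / complex_of_real (2 * L)" for L
    by (simp add: set_integral_add(2) add_divide_distrib)
  moreover have "(LINT t|torus d. F t + G t) = (LINT t|torus d. F t) + (LINT t|torus d. G t)"
    using add by (intro Bochner_Integration.integral_add torus_poly_integrable)
  ultimately show ?case using tendsto_add[OF add.IH] by simp
qed

subsection \<open>Means of the logarithm\<close>

lemma set_integrable_of_nn_integral_le:
  fixes f :: "'a \<Rightarrow> real"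
  assumes [measurable]: "f \<in> borel_measurable M" "S \<in> sets M"
    and pos: "\<And>x. 0 \<le> f x" and K: "0 \<le> K"
    and le: "(\<integral>\<^sup>+x. indicator S x * ennreal (f x) \<partial>M) \<le> ennreal K"
  shows "set_integrable M S f" "(LINT x:S|M. f x) \<le> K"
proof -
  have eq: "(\<integral>\<^sup>+x. indicator S x * ennreal (f x) \<partial>M) = (\<integral>\<^sup>+x. ennreal (indicator S x *\<^sub>R f x) \<partial>M)"
    by (intro nn_integral_cong) (auto split: split_indicator)
  show "set_integrable M S f"
    unfolding set_integrable_def
  proof (rule integrableI_nonneg)
    show "(\<integral>\<^sup>+x. ennreal (indicator S x *\<^sub>R f x) \<partial>M) < \<infinity>"
      using le unfolding eq by (rule le_less_trans) simp
  qed (use pos in \<open>auto intro!: AE_I2\<close>)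
  have "(LINT x:S|M. f x) = enn2real (\<integral>\<^sup>+x. ennreal (indicator S x *\<^sub>R f x) \<partial>M)"
    unfolding set_lebesgue_integral_def using pos by (intro integral_eq_nn_integral) (auto intro!: AE_I2)
  also have "\<dots> \<le> K" using le K unfolding eq by (intro enn2real_leI)
  finally show "(LINT x:S|M. f x) \<le> K" .
qed

lemma lebesgue_set_integral:
  fixes f :: "real \<Rightarrow> 'b::{banach, second_countable_topology}"
  assumes "f \<in> borel_measurable borel" "S \<in> sets borel"
  shows "set_integrable lebesgue S f \<longleftrightarrow> set_integrable lborel S f"
    and "(LINT y:S|lebesgue. f y) = (LINT y:S|lborel. f y)"
  using assms unfolding set_integrable_def set_lebesgue_integral_def
  by (auto intro!: integrable_completion integral_completion)

lemma norm_interval_mean_le: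
  fixes f :: "real \<Rightarrow> 'b::{real_normed_field, banach, second_countable_topology}"
  assumes f: "set_integrable lborel {-L..L} f" and L: "0 < L"
    and le: "\<And>y. norm (f y) \<le> e"
  shows "norm ((LINT y:{-L..L}|lborel. f y) / of_real (2 * L)) \<le> e"
proof -
  have "norm (LINT y:{-L..L}|lborel. f y) \<le> (LINT y:{-L..L}|lborel. norm (f y))"
    by (rule set_integral_norm_bound[OF f])
  also have "\<dots> \<le> (LINT y:{-L..L}|lborel. e)"
    using f le by (intro set_integral_mono set_integrable_norm borel_integrable_atLeastAtMost'[of _ _ "\<lambda>_. e"]) auto
  also have "\<dots> = 2 * L * e"
    using L by (simp add: set_lebesgue_integral_def)
  finally show ?thesis using L by (simp add: norm_divide field_simps)
qed

text \<open>Interchange of the limits in \<open>N\<close> and \<open>L\<close>. Comparing two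
  approximants at large \<open>L\<close> gives \<open>\<bar>I N - I M\<bar> \<le> T N + T M\<close>,
  so \<open>I\<close> is Cauchy, and uniform convergence carries its limit over to
  \<open>f\<close>.\<close>

lemma tendsto_of_uniform_approx:
  fixes f :: "real \<Rightarrow> real" and g :: "nat \<Rightarrow> real \<Rightarrow> real"
  assumes g: "\<And>N. (g N \<longlongrightarrow> I N) at_top" and T: "T \<longlonglongrightarrow> 0"
    and le: "\<And>N L. h \<le> L \<Longrightarrow> \<bar>f L - g N L\<bar> \<le> T N"
  obtains l where "I \<longlonglongrightarrow> l" "(f \<longlongrightarrow> l) at_top"
proof -
  have dI: "\<bar>I N - I M\<bar> \<le> T N + T M" for N M
  proof (rule tendsto_upperbound[OF tendsto_rabs[OF tendsto_diff[OF g[of N] g[of M]]]])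
    show "\<forall>\<^sub>F L in at_top. \<bar>g N L - g M L\<bar> \<le> T N + T M"
      using eventually_ge_at_top[of h]
    proof eventually_elim
      case (elim L)
      show ?case using le[OF elim, of N] le[OF elim, of M] by linarith
    qed
  qed simp
  have "Cauchy I"
  proof (rule metric_CauchyI)
    fix e :: real assume "0 < e"
    then obtain M where "\<And>N. N \<ge> M \<Longrightarrow> norm (T N - 0) < e / 2"
      using LIMSEQ_D[OF T, of "e/2"] by auto
    then have "dist (I m) (I n) < e" if "m \<ge> M" "n \<ge> M" for m n
      using dI[of m n] that unfolding dist_real_def by (smt (verit) field_sum_of_halves real_norm_def)
    then show "\<exists>M. \<forall>m\<ge>M. \<forall>n\<ge>M. dist (I m) (I n) < e" by blast
  qed
  then obtain l where l: "I \<longlonglongrightarrow> l" using Cauchy_convergent convergent_def by blast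
  have "(f \<longlongrightarrow> l) at_top"
  proof (rule swap_uniform_limit'[OF _ l, of g at_top "{h..}" f])
    show "uniform_limit {h..} g f sequentially"
    proof (rule uniform_limitI)
      fix e :: real assume "0 < e"
      then have "\<forall>\<^sub>F N in sequentially. T N < e" using T by (intro order_tendstoD)
      then show "\<forall>\<^sub>F N in sequentially. \<forall>x\<in>{h..}. dist (g N x) (f x) < e"
        by eventually_elim (auto simp: dist_real_def abs_minus_commute intro: le_less_trans[OF le])
    qed
  qed (auto intro: g eventually_ge_at_top always_eventually)
  with l show ?thesis by (rule that)
qed

text \<open>All information about small values of \<open>F\<close> is condensed in
  \<open>trunc\<close>, so the rest works for any torus polynomial satisfying that bound along the
  line with direction \<open>r\<close>.\<close>

locale log_truncation =
  fixes d :: nat and r :: "nat \<Rightarrow> real" and F :: "(nat \<Rightarrow> real) \<Rightarrow> complex"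
    and \<delta> T :: "nat \<Rightarrow> real" and h :: real
  assumes r: "inj_on r {1..d}" "rat_independent (r ` {1..d})"
    and F: "torus_poly d F"
    and h: "0 < h"
    and \<delta>_pos: "\<And>N. 0 < \<delta> N" and \<delta>_dec: "decseq \<delta>" and \<delta>_lim: "\<delta> \<longlonglongrightarrow> 0"
    and T_nonneg: "\<And>N. 0 \<le> T N" and T_lim: "T \<longlonglongrightarrow> 0"
    and trunc: "\<And>N L. h \<le> L \<Longrightarrow> (\<integral>\<^sup>+y. indicator {-L..L} y *
        ennreal (\<bar>ln (max (cmod (F (\<lambda>i. r i * y))) (\<delta> N)) - ln (cmod (F (\<lambda>i. r i * y)))\<bar> +
          (ln (max (cmod (F (\<lambda>i. r i * y))) (\<delta> N)) - ln (cmod (F (\<lambda>i. r i * y))))\<^sup>2) \<partial>lborel)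
        \<le> ennreal (2 * L * T N)"
begin

definition u :: "nat \<Rightarrow> (nat \<Rightarrow> real) \<Rightarrow> real" where
  "u N t = ln (max (cmod (F t)) (\<delta> N))"

definition D :: "nat \<Rightarrow> real \<Rightarrow> real" where
  "D N y = u N (\<lambda>i. r i * y) - ln (cmod (F (\<lambda>i. r i * y)))"

section \<open>Truncations and their errors along the line\<close>

lemma F_line_continuous: "continuous_on X (\<lambda>y. F (\<lambda>i. r i * y))"
  by (rule torus_poly_continuous_line[OF F])

lemma F_line_measurable [measurable]: "(\<lambda>y. F (\<lambda>i. r i * y)) \<in> borel_measurable borel"
  using F_line_continuous by (rule borel_measurable_continuous_onI)

lemma u_line_continuous: "continuous_on X (\<lambda>y. u N (\<lambda>i. r i * y))"
  unfolding u_def using \<delta>_pos[of N]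
  by (intro continuous_intros F_line_continuous) (auto simp: max_def)

lemma D_measurable [measurable]: "D N \<in> borel_measurable borel"
  unfolding D_def u_def by measurable

lemma D_integral:
  assumes "h \<le> L"
  shows "set_integrable lborel {-L..L} (D N)"
    and "set_integrable lborel {-L..L} (\<lambda>y. (D N y)\<^sup>2)"
    and "(LINT y:{-L..L}|lborel. \<bar>D N y\<bar>) \<le> 2 * L * T N"
    and "(LINT y:{-L..L}|lborel. (D N y)\<^sup>2) \<le> 2 * L * T N"
proof -
  have K: "0 \<le> 2 * L * T N" using assms h T_nonneg[of N] by simp
  have "(\<integral>\<^sup>+y. indicator {-L..L} y * ennreal (\<bar>D N y\<bar> + (D N y)\<^sup>2) \<partial>lborel) \<le> ennreal (2 * L * T N)"
    using trunc[OF assms, of N] by (simp add: D_def u_def)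
  then have le: "(\<integral>\<^sup>+y. indicator {-L..L} y * ennreal \<bar>D N y\<bar> \<partial>lborel) \<le> ennreal (2 * L * T N)"
      "(\<integral>\<^sup>+y. indicator {-L..L} y * ennreal ((D N y)\<^sup>2) \<partial>lborel) \<le> ennreal (2 * L * T N)"
    by (auto elim!: order_trans[rotated] intro!: nn_integral_mono mult_left_mono ennreal_leI)
  have 1: "set_integrable lborel {-L..L} (\<lambda>y. \<bar>D N y\<bar>)"
    by (rule set_integrable_of_nn_integral_le(1)[OF _ _ _ K le(1)]) auto
  then show "set_integrable lborel {-L..L} (D N)"
    by (rule set_integrable_bound) (auto simp: set_borel_measurable_def)
  show "set_integrable lborel {-L..L} (\<lambda>y. (D N y)\<^sup>2)"
    by (rule set_integrable_of_nn_integral_le(1)[OF _ _ _ K le(2)]) auto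
  show "(LINT y:{-L..L}|lborel. \<bar>D N y\<bar>) \<le> 2 * L * T N"
    by (rule set_integrable_of_nn_integral_le(2)[OF _ _ _ K le(1)]) auto
  show "(LINT y:{-L..L}|lborel. (D N y)\<^sup>2) \<le> 2 * L * T N"
    by (rule set_integrable_of_nn_integral_le(2)[OF _ _ _ K le(2)]) auto
qed

text \<open>
  Since \<open>u N\<close> is a continuous function of \<open>\<bar>F\<bar>\<^sup>2 = F \<cdot> cnj F\<close>, the Weierstrass theorem in one
  variable replaces its multivariate version on the torus.
\<close>

lemma u_approx:
  assumes "0 < e"
  obtains G where "torus_poly d G" "\<And>t. cmod (complex_of_real (u N t) - G t) \<le> e"
proof -
  obtain B where B: "\<And>t. cmod (F t) \<le> B" using torus_poly_bounded[OF F] by blast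
  have cont: "continuous_on {0..B\<^sup>2} (\<lambda>s. ln (max (sqrt s) (\<delta> N)))"
    using \<delta>_pos[of N] by (intro continuous_intros) (auto simp: max_def)
  obtain p where p: "real_polynomial_function p" "\<And>s. s \<in> {0..B\<^sup>2} \<Longrightarrow> \<bar>ln (max (sqrt s) (\<delta> N)) - p s\<bar> < e"
    using Stone_Weierstrass_real_polynomial_function[OF compact_Icc cont assms] by blast
  obtain a n where pa: "p = (\<lambda>s. \<Sum>i\<le>n. a i * s ^ i)" using real_polynomial_function_imp_sum[OF p(1)] by blast
  define G where "G t = (\<Sum>i\<le>n. complex_of_real (a i) * (F t * cnj (F t)) ^ i)" for t
  have "torus_poly d G"
    unfolding G_def
    by (intro torus_poly_sum torus_poly_mult torus_poly_const torus_poly_power torus_poly_cnj F) auto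
  moreover have "cmod (complex_of_real (u N t) - G t) \<le> e" for t
  proof -
    have "G t = complex_of_real (p ((cmod (F t))\<^sup>2))"
      by (simp add: G_def pa complex_norm_square[symmetric])
    moreover have "\<bar>ln (max (sqrt ((cmod (F t))\<^sup>2)) (\<delta> N)) - p ((cmod (F t))\<^sup>2)\<bar> < e"
      using B[of t] by (intro p(2)) (auto intro!: power_mono)
    ultimately show ?thesis
      by (simp add: u_def flip: of_real_diff)
  qed
  ultimately show ?thesis by (rule that)
qed

section \<open>Torus integrals and means of the truncations\<close>

lemma u_measurable [measurable]: "u N \<in> borel_measurable (torus d)"
  unfolding u_def using torus_poly_measurable[OF F] by measurable

text \<open>Uniformity in \<open>N\<close> comes from \<open>\<delta>\<close> decreasing from
  \<open>\<delta> 0\<close>; it is used to show that the zeros of \<open>F\<close> form a null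
  set.\<close>

lemma u_upper:
  obtains B where "\<And>N t. u N t \<le> B"
proof -
  obtain B where B: "\<And>t. cmod (F t) \<le> B" using torus_poly_bounded[OF F] by blast
  have "u N t \<le> ln (max B (\<delta> 0))" for N t
    unfolding u_def using \<delta>_pos[of N] \<delta>_pos[of 0] decseqD[OF \<delta>_dec, of 0 N] B[of t]
    by (subst ln_le_cancel_iff) (auto simp: max_def)
  then show ?thesis by (rule that)
qed

lemma u_integrable: "integrable (torus d) (u N)"
proof -
  interpret finite_measure "torus d" by (rule finite_measure_torus)
  obtain B where B: "\<And>N t. u N t \<le> B" using u_upper by blast
  have "ln (\<delta> N) \<le> u N t" for t unfolding u_def using \<delta>_pos[of N] by (subst ln_le_cancel_iff) (auto simp: max_def)
  then have "norm (u N t) \<le> max \<bar>B\<bar> \<bar>ln (\<delta> N)\<bar>" for t using B[of N t] by (smt (verit) real_norm_def)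
  then show ?thesis by (intro integrable_const_bound[of _ "max \<bar>B\<bar> \<bar>ln (\<delta> N)\<bar>"]) auto
qed

text \<open>Equidistribution extends from torus polynomials to \<open>u N\<close>: a torus
  polynomial uniformly within \<open>e / 3\<close> changes each of the two means by at most
  \<open>e / 3\<close>. The argument runs over the complex numbers because \<open>torus_poly\<close>
  is complex valued.\<close>

lemma u_mean:
  "((\<lambda>L. (LINT y:{-L..L}|lborel. u N (\<lambda>i. r i * y)) / (2 * L)) \<longlongrightarrow> (LINT t|torus d. u N t)) at_top"
proof -
  let ?u = "\<lambda>y. complex_of_real (u N (\<lambda>i. r i * y))"
  let ?m = "\<lambda>f L. (LINT y:{-L..L}|lborel. f y) / complex_of_real (2 * L)"
  have "((\<lambda>L. ?m ?u L) \<longlongrightarrow> (LINT t|torus d. complex_of_real (u N t))) at_top"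
  proof (rule tendstoI)
    fix e :: real assume e: "0 < e"
    obtain G where G: "torus_poly d G" "\<And>t. cmod (complex_of_real (u N t) - G t) \<le> e / 3"
      using u_approx[of "e / 3" N] e by auto
    have "((\<lambda>L. ?m (\<lambda>y. G (\<lambda>i. r i * y)) L) \<longlongrightarrow> (LINT t|torus d. G t)) at_top"
      by (rule torus_poly_mean[OF r G(1)])
    then have "\<forall>\<^sub>F L in at_top. dist (?m (\<lambda>y. G (\<lambda>i. r i * y)) L) (LINT t|torus d. G t) < e / 3"
      using e by (intro tendstoD) auto
    then show "\<forall>\<^sub>F L in at_top. dist (?m ?u L) (LINT t|torus d. complex_of_real (u N t)) < e"
      using eventually_gt_at_top[of 0]
    proof eventually_elim
      case (elim L)
      have iu: "set_integrable lborel {-L..L} ?u" and iG: "set_integrable lborel {-L..L} (\<lambda>y. G (\<lambda>i. r i * y))"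
        using torus_poly_continuous_line[OF G(1)] u_line_continuous
        by (auto intro!: borel_integrable_atLeastAtMost' continuous_intros)
      have "cmod (?m (\<lambda>y. ?u y - G (\<lambda>i. r i * y)) L) \<le> e / 3"
        using iu iG elim G(2) by (intro norm_interval_mean_le set_integral_diff) auto
      then have 1: "dist (?m ?u L) (?m (\<lambda>y. G (\<lambda>i. r i * y)) L) \<le> e / 3"
        using iu iG by (simp add: dist_norm set_integral_diff diff_divide_distrib)
      have int: "integrable (torus d) (\<lambda>t. complex_of_real (u N t))" "integrable (torus d) G"
        by (auto intro: u_integrable torus_poly_integrable G)
      interpret finite_measure "torus d" by (rule finite_measure_torus)
      have "cmod (LINT t|torus d. complex_of_real (u N t) - G t) \<le> (LINT t|torus d. cmod (complex_of_real (u N t) - G t))"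
        by (rule integral_norm_bound)
      also have "\<dots> \<le> (LINT t|torus d. e / 3)"
        using int G(2) by (intro integral_mono) auto
      also have "\<dots> = e / 3" by (simp add: measure_def emeasure_torus)
      finally have 2: "dist (LINT t|torus d. G t) (LINT t|torus d. complex_of_real (u N t)) \<le> e / 3"
        using int by (simp add: dist_norm norm_minus_commute)
      show ?case using 1 2 elim(1)
          dist_triangle[of "?m ?u L" "LINT t|torus d. complex_of_real (u N t)" "?m (\<lambda>y. G (\<lambda>i. r i * y)) L"]
          dist_triangle[of "?m (\<lambda>y. G (\<lambda>i. r i * y)) L" "LINT t|torus d. complex_of_real (u N t)" "LINT t|torus d. G t"]
        by linarith
    qed
  qed
  moreover have "?m ?u L = complex_of_real ((LINT y:{-L..L}|lborel. u N (\<lambda>i. r i * y)) / (2 * L))" for L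
    by (simp add: set_integral_complex_of_real)
  ultimately show ?thesis
    by (simp only: integral_complex_of_real tendsto_of_real_iff)
qed

section \<open>From the truncations to the mean of the logarithm\<close>

lemma log_mean_diff:
  assumes L: "h \<le> L"
  shows "\<bar>(LINT y:{-L..L}|lborel. ln (cmod (F (\<lambda>i. r i * y)))) / (2 * L) -
      (LINT y:{-L..L}|lborel. u N (\<lambda>i. r i * y)) / (2 * L)\<bar> \<le> T N"
proof -
  have iu: "set_integrable lborel {-L..L} (\<lambda>y. u N (\<lambda>i. r i * y))"
    using u_line_continuous by (rule borel_integrable_atLeastAtMost')
  have "(LINT y:{-L..L}|lborel. ln (cmod (F (\<lambda>i. r i * y)))) = (LINT y:{-L..L}|lborel. u N (\<lambda>i. r i * y) - D N y)"
    by (simp add: D_def)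
  also have "\<dots> = (LINT y:{-L..L}|lborel. u N (\<lambda>i. r i * y)) - (LINT y:{-L..L}|lborel. D N y)"
    by (rule set_integral_diff(2)[OF iu D_integral(1)[OF L]])
  finally have "(LINT y:{-L..L}|lborel. ln (cmod (F (\<lambda>i. r i * y)))) - (LINT y:{-L..L}|lborel. u N (\<lambda>i. r i * y))
      = - (LINT y:{-L..L}|lborel. D N y)" by simp
  moreover have "\<bar>LINT y:{-L..L}|lborel. D N y\<bar> \<le> 2 * L * T N"
    using set_integral_norm_bound[OF D_integral(1)[OF L, of N]] D_integral(3)[OF L, of N] by simp
  ultimately have "\<bar>(LINT y:{-L..L}|lborel. ln (cmod (F (\<lambda>i. r i * y)))) - (LINT y:{-L..L}|lborel. u N (\<lambda>i. r i * y))\<bar> \<le> 2 * L * T N"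
    by simp
  then show ?thesis using L h
    by (simp add: diff_divide_distrib[symmetric] abs_mult field_simps)
qed

text \<open>Interchanging limits gives existence, with the limit of the torus integrals of
  \<open>u N\<close> as value. Monotone convergence identifies that value once the zeros of
  \<open>F\<close> are known to be a null set.\<close>

lemma log_mean_tendsto:
  "((\<lambda>L. (LINT y:{-L..L}|lborel. ln (cmod (F (\<lambda>i. r i * y)))) / (2 * L)) \<longlongrightarrow> (LINT t|torus d. ln (cmod (F t)))) at_top"
proof -
  interpret finite_measure "torus d" by (rule finite_measure_torus)
  note [measurable] = torus_poly_measurable[OF F]
  obtain l where l: "(\<lambda>N. LINT t|torus d. u N t) \<longlonglongrightarrow> l"
    "((\<lambda>L. (LINT y:{-L..L}|lborel. ln (cmod (F (\<lambda>i. r i * y)))) / (2 * L)) \<longlongrightarrow> l) at_top"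
    using tendsto_of_uniform_approx[OF u_mean T_lim log_mean_diff] by blast
  obtain B where B: "\<And>N t. u N t \<le> B" using u_upper by blast
  define Z where "Z = {t\<in>space (torus d). F t = 0}"
  have Z [measurable]: "Z \<in> sets (torus d)" unfolding Z_def by measurable
  have "(\<lambda>N. B - (LINT t|torus d. u N t)) \<longlonglongrightarrow> B - l" by (intro tendsto_intros l)
  then have "Bseq (\<lambda>N. B - (LINT t|torus d. u N t))"
    by (rule convergent_imp_Bseq[OF convergentI])
  then obtain X where X: "\<And>N. norm (B - (LINT t|torus d. u N t)) \<le> X"
    unfolding Bseq_def by blast
  \<comment> \<open>On \<open>Z\<close> the truncation equals \<open>ln (\<delta> N)\<close>, which
    tends to minus infinity, while the integrals of \<open>B - u N\<close> stay below
    \<open>X\<close>. This forces \<open>Z\<close> to have measure 0.\<close>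
  have ZN: "measure (torus d) Z * (B - ln (\<delta> N)) \<le> X" for N
  proof -
    have "measure (torus d) Z * (B - ln (\<delta> N)) = (LINT t|torus d. indicator Z t * (B - ln (\<delta> N)))"
      by simp
    also have "\<dots> \<le> (LINT t|torus d. B - u N t)"
    proof (rule integral_mono)
      show "indicator Z t * (B - ln (\<delta> N)) \<le> B - u N t" if "t \<in> space (torus d)" for t
        using B[of N t] \<delta>_pos[of N] by (auto simp: u_def Z_def max_def split: split_indicator)
    qed (use u_integrable Z in \<open>auto intro!: integrable_real_indicator simp: emeasure_eq_measure\<close>)
    also have "\<dots> = B - (LINT t|torus d. u N t)"
      by (subst Bochner_Integration.integral_diff) (auto simp: u_integrable measure_def emeasure_torus)
    also have "\<dots> \<le> X" using X[of N] by simp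
    finally show ?thesis .
  qed
  have "measure (torus d) Z = 0"
  proof (rule ccontr)
    assume "\<not> ?thesis"
    then have Zpos: "0 < measure (torus d) Z" by (simp add: zero_less_measure_iff)
    \<comment> \<open>\<open>\<delta> N < R\<close> is the inequality contradicting
      \<open>ZN\<close>, solved for \<open>\<delta> N\<close>.\<close>
    define R where "R = exp (B - X / measure (torus d) Z)"
    obtain N where "\<delta> N < R"
      using order_tendstoD(2)[OF \<delta>_lim, of R] by (auto simp: R_def eventually_sequentially)
    then have "ln (\<delta> N) < B - X / measure (torus d) Z"
      unfolding R_def using \<delta>_pos[of N] by (metis exp_gt_zero ln_exp ln_less_cancel_iff)
    then have "X / measure (torus d) Z < B - ln (\<delta> N)" by simp
    then have "X < measure (torus d) Z * (B - ln (\<delta> N))"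
      using Zpos by (simp add: field_simps)
    with ZN[of N] show False by simp
  qed
  then have "Z \<in> null_sets (torus d)" using Z by (simp add: null_sets_def emeasure_eq_measure)
  then have AE: "AE t in torus d. F t \<noteq> 0"
    by (rule AE_I') (auto simp: Z_def)
  \<comment> \<open>The signs are reversed because \<open>u N\<close> decreases in \<open>N\<close>,
    whereas \<open>integral_monotone_convergence\<close> is about increasing sequences.\<close>
  have "(LINT t|torus d. - ln (cmod (F t))) = - l"
  proof (rule integral_monotone_convergence)
    show "integrable (torus d) (\<lambda>t. - u N t)" for N using u_integrable by simp
    show "AE t in torus d. mono (\<lambda>N. - u N t)"
    proof (rule AE_I2, rule monoI)
      fix t and M N :: nat assume "M \<le> N"
      then show "- u M t \<le> - u N t"
        unfolding u_def using decseqD[OF \<delta>_dec, of M N] \<delta>_pos[of M] \<delta>_pos[of N]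
        by simp
    qed
    show "AE t in torus d. (\<lambda>N. - u N t) \<longlonglongrightarrow> - ln (cmod (F t))"
      using AE
    proof eventually_elim
      case (elim t)
      then have "\<forall>\<^sub>F N in sequentially. \<delta> N < cmod (F t)" by (intro order_tendstoD(2)[OF \<delta>_lim]) auto
      then have "\<forall>\<^sub>F N in sequentially. - u N t = - ln (cmod (F t))"
        by eventually_elim (simp add: u_def max_def)
      then show ?case by (rule tendsto_eventually)
    qed
    show "(\<lambda>N. LINT t|torus d. - u N t) \<longlonglongrightarrow> - l"
      using tendsto_minus[OF l(1)] by simp
  qed measurable
  then show ?thesis using l(2) by simp
qed

section \<open>Mean square approximation of the logarithm\<close>

lemma log_square_integrable:
  assumes "h \<le> L"
  shows "set_integrable lborel {-L..L} (\<lambda>y. (ln (cmod (F (\<lambda>i. r i * y))))\<^sup>2)"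
proof (rule set_integrable_bound)
  have "set_integrable lborel {-L..L} (\<lambda>y. (u 0 (\<lambda>i. r i * y))\<^sup>2)"
    by (intro borel_integrable_atLeastAtMost' continuous_intros u_line_continuous)
  then show "set_integrable lborel {-L..L} (\<lambda>y. 2 * (u 0 (\<lambda>i. r i * y))\<^sup>2 + 2 * (D 0 y)\<^sup>2)"
    using D_integral(2)[OF assms, of 0] by (intro set_integral_add set_integrable_mult_right) auto
  \<comment> \<open>The right side minus the left is the square of \<open>2 * v - x\<close>. It is
    applied with \<open>v\<close> the truncation, so that \<open>v - x\<close> is
    \<open>D 0 y\<close>.\<close>
  have sq: "x\<^sup>2 \<le> 2 * v\<^sup>2 + 2 * (v - x)\<^sup>2" for x v :: real
    using zero_le_power2[of "2 * v - x"] by (simp add: power2_eq_square algebra_simps)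
  show "AE y in lborel. y \<in> {-L..L} \<longrightarrow> norm ((ln (cmod (F (\<lambda>i. r i * y))))\<^sup>2) \<le> norm (2 * (u 0 (\<lambda>i. r i * y))\<^sup>2 + 2 * (D 0 y)\<^sup>2)"
    using sq unfolding D_def by (intro AE_I2) simp
qed (auto simp: set_borel_measurable_def)

text \<open>The approximant is a torus polynomial uniformly close to \<open>u N\<close>, restricted
  to the line; \<open>T N\<close> controls the truncation error in mean square.\<close>

lemma besicovitch_log: "besicovitch_ap2 (\<lambda>y. complex_of_real (ln (cmod (F (\<lambda>i. r i * y)))))"
  unfolding besicovitch_ap2_def
proof (intro conjI allI impI)
  let ?l = "\<lambda>y. ln (cmod (F (\<lambda>i. r i * y)))"
  show "(\<lambda>y. complex_of_real (?l y)) \<in> borel_measurable lebesgue"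
    by (intro measurable_completion) measurable
  show "set_integrable lebesgue K (\<lambda>y. (cmod (complex_of_real (?l y)))\<^sup>2)" if K: "compact K" for K
  proof -
    obtain b where b: "\<And>y. y \<in> K \<Longrightarrow> \<bar>y\<bar> \<le> b"
      using compact_imp_bounded[OF K] by (auto simp: bounded_iff)
    \<comment> \<open>The integral bounds are available only from \<open>h\<close> on, hence the
      maximum.\<close>
    define L where "L = max h b"
    have "K \<subseteq> {-L..L}" using b by (force simp: L_def abs_le_iff)
    then have "set_integrable lborel K (\<lambda>y. (?l y)\<^sup>2)"
      using K by (intro set_integrable_subset[OF log_square_integrable[of L]])
        (auto simp: L_def intro: borel_compact)
    then show ?thesis
      using K by (subst lebesgue_set_integral) (auto intro: borel_compact)
  qed
  fix e :: real assume e: "0 < e"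
  \<comment> \<open>Error budget: splitting the square doubles both parts, so the mean square is at
    most \<open>2 * T N\<close>, below \<open>e / 4\<close>, plus twice \<open>e / 8\<close>. The
    total \<open>e / 2\<close> leaves room for the strict inequality after
    \<open>Limsup\<close>.\<close>
  obtain N where N: "T N < e / 8"
    using order_tendstoD(2)[OF T_lim, of "e / 8"] e by (auto simp: eventually_sequentially)
  obtain G where G: "torus_poly d G" "\<And>t. cmod (complex_of_real (u N t) - G t) \<le> sqrt (e / 8)"
    using u_approx[of "sqrt (e / 8)" N] e by auto
  define Q where "Q y = G (\<lambda>i. r i * y)" for y
  have Qc: "continuous_on X Q" for X unfolding Q_def by (rule torus_poly_continuous_line[OF G(1)])
  then have [measurable]: "Q \<in> borel_measurable borel" by (rule borel_measurable_continuous_onI)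
  have ptw: "(cmod (complex_of_real (?l y) - Q y))\<^sup>2 \<le> 2 * (D N y)\<^sup>2 + e / 4" for y
  proof -
    let ?v = "cmod (complex_of_real (u N (\<lambda>i. r i * y)) - Q y)"
    have "cmod (complex_of_real (?l y) - Q y) \<le> \<bar>D N y\<bar> + ?v"
      using norm_triangle_ineq[of "complex_of_real (- D N y)" "complex_of_real (u N (\<lambda>i. r i * y)) - Q y"]
      by (simp only: norm_of_real) (simp add: D_def)
    then have "(cmod (complex_of_real (?l y) - Q y))\<^sup>2 \<le> (\<bar>D N y\<bar> + ?v)\<^sup>2"
      by (intro power_mono) auto
    also have "\<dots> \<le> 2 * (D N y)\<^sup>2 + 2 * ?v\<^sup>2"
      using zero_le_power2[of "\<bar>D N y\<bar> - ?v"] by (simp add: power2_sum power2_diff)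
    also have "?v\<^sup>2 \<le> (sqrt (e / 8))\<^sup>2"
      unfolding Q_def by (intro power_mono G(2)) auto
    finally show ?thesis using e by simp
  qed
  have bound: "1 / (2 * L) * (LINT y:{-L..L}|lebesgue. (cmod (complex_of_real (?l y) - Q y))\<^sup>2) \<le> e / 2"
    if L: "h \<le> L" for L
  proof -
    have Lpos: "0 < L" using L h by simp
    have i1: "set_integrable lborel {-L..L} (\<lambda>y. 2 * (D N y)\<^sup>2)"
      using D_integral(2)[OF L, of N] by simp
    have i2: "set_integrable lborel {-L..L} (\<lambda>y. e / 4)"
      by (intro borel_integrable_atLeastAtMost') auto
    have i3: "set_integrable lborel {-L..L} (\<lambda>y. (cmod (complex_of_real (?l y) - Q y))\<^sup>2)"
      by (rule set_integrable_bound[OF set_integral_add(1)[OF i1 i2]])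
         (use ptw in \<open>auto simp: set_borel_measurable_def intro!: AE_I2 intro: order_trans[OF _ abs_ge_self]\<close>)
    have "(LINT y:{-L..L}|lebesgue. (cmod (complex_of_real (?l y) - Q y))\<^sup>2)
        = (LINT y:{-L..L}|lborel. (cmod (complex_of_real (?l y) - Q y))\<^sup>2)"
      by (rule lebesgue_set_integral) measurable
    also have "\<dots> \<le> (LINT y:{-L..L}|lborel. 2 * (D N y)\<^sup>2 + e / 4)"
      by (intro set_integral_mono i3 set_integral_add i1 i2 ptw)
    also have "\<dots> = 2 * (LINT y:{-L..L}|lborel. (D N y)\<^sup>2) + 2 * L * (e / 4)"
      using Lpos by (subst set_integral_add(2)[OF i1 i2]) (simp add: set_lebesgue_integral_def)
    also have "\<dots> \<le> 2 * (2 * L * T N) + 2 * L * (e / 4)"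
      using D_integral(4)[OF L, of N] by simp
    also have "\<dots> \<le> 2 * L * (e / 2)"
    proof -
      have "2 * (2 * L * T N) \<le> 2 * (2 * L * (e / 8))"
        using N Lpos by (intro mult_left_mono) auto
      then show ?thesis by (simp add: algebra_simps)
    qed
    finally show ?thesis using Lpos by (simp add: field_simps)
  qed
  have "Limsup at_top (\<lambda>L. ereal (1 / (2 * L) * (LINT y:{-L..L}|lebesgue. (cmod (complex_of_real (?l y) - Q y))\<^sup>2)))
      \<le> ereal (e / 2)"
    by (intro Limsup_bounded eventually_mono[OF eventually_ge_at_top[of h]]) (simp only: ereal_less_eq bound)
  also have "\<dots> < ereal e" using e by simp
  finally show "\<exists>Q. trig_poly Q \<and> Limsup at_top (\<lambda>L. ereal (1 / (2 * L) * (LINT y:{-L..L}|lebesgue. (cmod (complex_of_real (?l y) - Q y))\<^sup>2))) < ereal e"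
    using torus_poly_trig_poly_line[OF G(1)] unfolding Q_def by blast
qed

end

section \<open>Application to the normalised exponential sum \<open>A\<close>\<close>

theorem theorem1:
  fixes lam :: real
    and m :: nat
    and a :: "nat \<Rightarrow> complex"
    and \<tau> :: "nat \<Rightarrow> real"
    and A :: "real \<Rightarrow> complex"
    and d :: nat
    and r :: "nat \<Rightarrow> real"
    and P :: laurent_poly
  assumes "lam \<notin> {-1..1}"
    and "m \<ge> 1"
    and "\<forall>j\<in>{1..m}. a j \<noteq> 0"
    and "(\<Sum>j=1..m. a j) = complex_of_real \<bar>lam\<bar>"
    and "strict_mono_on {1..m} \<tau>"
    and "A = (\<lambda>y. inverse (complex_of_real \<bar>lam\<bar>) * (\<Sum>j=1..m. a j * e2pi (\<tau> j * y)))"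
    and "d = Max {card S | S. S \<subseteq> \<tau> ` {1..m} \<and> rat_independent S}"
    and "inj_on r {1..d}"
    and "rat_independent (r ` {1..d})"
    and "laurent_in d P"
    and "\<forall>y. A y = laurent_eval P (\<lambda>i. e2pi (r i * y))"
  shows "besicovitch_ap2 (\<lambda>y. complex_of_real (ln (cmod (A y)))) \<and>
    ((\<lambda>L. 1 / (2 * L) * (LINT y : {-L..L} | lebesgue. ln (cmod (A y))))
       \<longlongrightarrow> ln (mahler_measure d P)) at_top"
proof -
  \<comment> \<open>The normalising factor is absorbed into the coefficients, which makes
    \<open>A\<close> literally an \<open>exp_sum\<close>.\<close>
  define b where "b j = inverse (complex_of_real \<bar>lam\<bar>) * a j" for j
  have lam: "lam \<noteq> 0" using assms(1) by auto
  have A: "A = exp_sum {1..m} b \<tau> 0"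
    unfolding assms(6) exp_sum_def b_def by (simp add: fun_eq_iff sum_distrib_left mult.assoc)
  \<comment> \<open>Index 1 is available because \<open>m \<ge> 1\<close>, and its coefficient stays
    nonzero after scaling.\<close>
  have b: "finite {1..m}" "inj_on \<tau> {1..m}" "1 \<in> {1..m}" "b 1 \<noteq> 0"
    using assms(2,3) lam strict_mono_on_imp_inj_on[OF assms(5)] by (auto simp: b_def)
  define F where "F t = laurent_eval P (\<lambda>i. e2pi (t i))" for t
  have AF: "A y = F (\<lambda>i. r i * y)" for y using assms(11) by (simp add: F_def)
  have F: "torus_poly d F"
    using torus_poly_laurent_eval[OF assms(10)] by (simp add: F_def[abs_def])
  obtain \<delta> T h where trunc: "0 < h" "\<And>N. 0 < \<delta> N" "decseq \<delta>" "\<delta> \<longlonglongrightarrow> 0" "\<And>N. 0 \<le> T N" "T \<longlonglongrightarrow> 0"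
    "\<And>N L. h \<le> L \<Longrightarrow> (\<integral>\<^sup>+y. indicator {-L..L} y *
        ennreal (\<bar>ln (max (cmod (A y)) (\<delta> N)) - ln (cmod (A y))\<bar> +
          (ln (max (cmod (A y)) (\<delta> N)) - ln (cmod (A y)))\<^sup>2) \<partial>lborel)
        \<le> ennreal (2 * L * T N)"
    by (rule exp_sum_log_truncation[of "{1..m}" \<tau> 1 b, OF b, folded A], rule that)
  interpret log_truncation d r F \<delta> T h
    by unfold_locales (fact assms(8) assms(9) F trunc trunc[unfolded AF])+
  have "ln (mahler_measure d P) = (LINT t|torus d. ln (cmod (F t)))"
    unfolding mahler_measure_def integral_torus F_def by simp
  moreover have "(LINT y : {-L..L} | lebesgue. ln (cmod (A y))) = (LINT y : {-L..L} | lborel. ln (cmod (F (\<lambda>i. r i * y))))" for L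
    unfolding AF by (rule lebesgue_set_integral) measurable
  ultimately show ?thesis
    using besicovitch_log log_mean_tendsto by (simp add: AF)
qed

end
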